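(* Let $I,J$ be ordered subsets of $\{1,\dots,n\}$. Then $\tilde L_2(e_I\cdot{\bf v}_{\mathcal I},e_J\cdot{\bf v}_{\mathcal I})\neq 0$ (as an element of $C^2$) if and only if $I$ and $J$ satisfy one of the following conditions, where $a\neq b$ denote elements of $\{1,\dots,n\}$: (a) $I\cap J=\emptyset$ and $I^c\cap J^c=\{a,b\}$; (b) $I\cap J=\{a,b\}$ and $I^c\cap J^c=\emptyset$; (c) $I\cap J=\{b\}$ and $I^c\cap J^c=\{a\}$; (d) $I\cap J=\emptyset$ and $I^c\cap J^c=\emptyset$. In those cases, for every ordered subset $K$ of $\{1,\dots,n\}$: in case (a), $\tilde L_2(e_I\cdot{\bf v}_{\mathcal I},e_J\cdot{\bf v}_{\mathcal I})e_K\cdot{\bf v}_{\mathcal I}=2B(e_ae_be_I\cdot{\bf v}_{\mathcal I},e_J\cdot{\bf v}_{\mathcal I})\,i_ai_be_K\cdot{\bf v}_{\mathcal I}$; in case (b), $\tilde L_2(e_I\cdot{\bf v}_{\mathcal I},e_J\cdot{\bf v}_{\mathcal I})e_K\cdot{\bf v}_{\mathcal I}=2B(i_ai_be_I\cdot{\bf v}_{\mathcal I},e_J\cdot{\bf v}_{\mathcal I})\,e_ae_be_K\cdot{\bf v}_{\mathcal I}$; in case (c), $\tilde L_2(e_I\cdot{\bf v}_{\mathcal I},e_J\cdot{\bf v}_{\mathcal I})e_K\cdot{\bf v}_{\mathcal I}=2B(e_ai_be_I\cdot{\bf v}_{\mathcal I},e_J\cdot{\bf v}_{\mathcal I})\,i_ae_be_K\cdot{\bf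 v}_{\mathcal I}$; in case (d), $\tilde L_2(e_I\cdot{\bf v}_{\mathcal I},e_J\cdot{\bf v}_{\mathcal I})e_K\cdot{\bf v}_{\mathcal I}=\frac12B(e_I\cdot{\bf v}_{\mathcal I},e_J\cdot{\bf v}_{\mathcal I})\,(n-2|I\cap K|-2|I^c\cap K^c|)\,e_K\cdot{\bf v}_{\mathcal I}$.
   Context: $k$ is a field of characteristic not $2$ or $3$; $V$ is a $2n$-dimensional $k$-vector space with a nondegenerate symmetric bilinear form $g$ of Witt index $n$ (hyperbolic). $C=C(V,g)$ is the Clifford algebra, $vw+wv=2g(v,w)1$ for $v,w\in V\subset C$. $S$ is a fixed $2^n$-dimensional $k$-vector space (spinors) with an algebra isomorphism $C\cong End(S)$; $c\cdot\psi$ (or $c\psi$) denotes the action of $c\in C$ on $\psi\in S$. A spinor norm is a bilinear map $B:S\times S\to k$ with $B(v\cdot\phi,\psi)=B(\phi,v\cdot\psi)$ for all $v\in V$, $\phi,\psi\in S$; a nondegenerate spinor norm $B$ is fixed. An orthonormal basis of $V$ is a basis $x_1,\dots,x_{2n}$ with $g(x_i,x_j)=\pm\delta_{ij}$. $C^2\subset C$ is the span of the products $x_ix_j$, $i<j$. The map $\tilde L_2:S\times S\to C^2$ is $\tilde L_2(\phi,\psi)=\frac12\sum_{i<j}g(x_i,x_i)g(x_j,x_j)B(\phi,x_jx_i\cdot\psi)\,x_ix_j$ for any orthonormal basis (independent of the choice). $V={\mathcal I}\oplus{\mathcal E}$ is a polarisation: both summands are $n$-dimensional subspaces on which $g$ vanishes;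 $i_1,\dots,i_n$ and $e_1,\dots,e_n$ are bases of ${\mathcal I}$ and ${\mathcal E}$ with $g(e_a,i_b)=\frac12\delta_{ab}$. ${\bf v}_{\mathcal I}\in S$ is a pure spinor of ${\mathcal I}$: the nonzero element, unique up to scalar, with $i_a\cdot{\bf v}_{\mathcal I}=0$ for all $a$. For an ordered subset $K=\{k_1,\dots,k_p\}$ (listed in its order) set $e_K=e_{k_1}\cdots e_{k_p}$, $e_\emptyset=1$; the $e_K\cdot{\bf v}_{\mathcal I}$ (one ordering per subset) form a basis of $S$. $I^c$ denotes the complement in $\{1,\dots,n\}$; set operations ignore the orderings. *)

theory Defs
  imports HOL.Vector_Spaces "HOL-Library.Poly_Mapping" "HOL-Algebra.QuotRing"
begin

section \<open>Quadratic spaces\<close>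

text \<open>Vector spaces are whole types with an explicit scalar multiplication (library locale
  \<^locale>\<open>vector_space\<close>), so that their dimension can be an arbitrary natural number.\<close>

definition bilinear_map ::
    "('k::field \<Rightarrow> 'a::ab_group_add \<Rightarrow> 'a) \<Rightarrow> ('a \<Rightarrow> 'a \<Rightarrow> 'k) \<Rightarrow> bool" where
  "bilinear_map scale b \<longleftrightarrow>
     (\<forall>x. Vector_Spaces.linear scale (*) (b x)) \<and>
     (\<forall>y. Vector_Spaces.linear scale (*) (\<lambda>x. b x y))"

definition nondegenerate :: "('a::ab_group_add \<Rightarrow> 'a \<Rightarrow> 'k::field) \<Rightarrow> bool" where
  "nondegenerate b \<longleftrightarrow>
     (\<forall>x. (\<forall>y. b x y = 0) \<longrightarrow> x = 0) \<and> (\<forall>y. (\<forall>x. b x y = 0) \<longrightarrow> y = 0)"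

definition totally_isotropic :: "('v \<Rightarrow> 'v \<Rightarrow> 'k::field) \<Rightarrow> 'v set \<Rightarrow> bool" where
  "totally_isotropic g W \<longleftrightarrow> (\<forall>v\<in>W. \<forall>w\<in>W. g v w = 0)"

definition witt_index ::
    "('k::field \<Rightarrow> 'v::ab_group_add \<Rightarrow> 'v) \<Rightarrow> ('v \<Rightarrow> 'v \<Rightarrow> 'k) \<Rightarrow> nat" where
  "witt_index scale g =
     (GREATEST m. \<exists>W. module.subspace scale W \<and> totally_isotropic g W \<and>
                      vector_space.dim scale W = m)"

definition indexed_basis ::
    "('k::field \<Rightarrow> 'v::ab_group_add \<Rightarrow> 'v) \<Rightarrow> nat \<Rightarrow> 'v set \<Rightarrow> (nat \<Rightarrow> 'v) \<Rightarrow> bool" where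
  "indexed_basis scale N W x \<longleftrightarrow>
     inj_on x {1..N} \<and> \<not> module.dependent scale (x ` {1..N}) \<and>
     module.span scale (x ` {1..N}) = W"

definition orthonormal_basis ::
    "('k::field \<Rightarrow> 'v::ab_group_add \<Rightarrow> 'v) \<Rightarrow> ('v \<Rightarrow> 'v \<Rightarrow> 'k) \<Rightarrow> nat \<Rightarrow> (nat \<Rightarrow> 'v) \<Rightarrow> bool" where
  "orthonormal_basis scale g N x \<longleftrightarrow>
     indexed_basis scale N UNIV x \<and>
     (\<forall>i\<in>{1..N}. g (x i) (x i) = 1 \<or> g (x i) (x i) = - 1) \<and>
     (\<forall>i\<in>{1..N}. \<forall>j\<in>{1..N}. i \<noteq> j \<longrightarrow> g (x i) (x j) = 0)"

definition polarisation ::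
    "('k::field \<Rightarrow> 'v::ab_group_add \<Rightarrow> 'v) \<Rightarrow> ('v \<Rightarrow> 'v \<Rightarrow> 'k) \<Rightarrow> nat \<Rightarrow> 'v set \<Rightarrow> 'v set \<Rightarrow> bool" where
  "polarisation scale g n \<I> \<E> \<longleftrightarrow>
     module.subspace scale \<I> \<and> module.subspace scale \<E> \<and>
     vector_space.dim scale \<I> = n \<and> vector_space.dim scale \<E> = n \<and>
     totally_isotropic g \<I> \<and> totally_isotropic g \<E> \<and>
     \<I> \<inter> \<E> = {0} \<and> (\<forall>v. \<exists>a\<in>\<I>. \<exists>b\<in>\<E>. v = a + b)"

section \<open>The Clifford algebra\<close>

text \<open>Words under concatenation are the free monoid, so \<open>'v list \<Rightarrow>\<^sub>0 'k\<close> with convolution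
  product is the free unital associative \<open>'k\<close>-algebra on the underlying set of \<open>'v\<close>.\<close>

instantiation list :: (type) monoid_add
begin
definition zero_list :: "'a list" where "zero_list = []"
definition plus_list :: "'a list \<Rightarrow> 'a list \<Rightarrow> 'a list" where "plus_list = (@)"
instance by standard (simp_all add: zero_list_def plus_list_def)
end

type_synonym ('v, 'k) clifford = "('v list \<Rightarrow>\<^sub>0 'k) set"

definition free_algebra :: "('v list \<Rightarrow>\<^sub>0 'k::field) ring" where
  "free_algebra = \<lparr>carrier = UNIV, mult = (*), one = 1, zero = 0, add = (+)\<rparr>"

text \<open>The first two families of relations make the generators \<open>v\<close> depend linearly on \<open>v\<close> (their
  quotient is the tensor algebra); the third is \<open>v w + w v = 2 g(v,w) 1\<close>.\<close>

definition clifford_relations ::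
    "('k::field \<Rightarrow> 'v::ab_group_add \<Rightarrow> 'v) \<Rightarrow> ('v \<Rightarrow> 'v \<Rightarrow> 'k) \<Rightarrow> ('v list \<Rightarrow>\<^sub>0 'k) set" where
  "clifford_relations scale g =
     {Poly_Mapping.single [v + w] 1 - Poly_Mapping.single [v] 1 - Poly_Mapping.single [w] 1 |v w. True} \<union>
     {Poly_Mapping.single [scale c v] 1 - Poly_Mapping.single [v] c |c v. True} \<union>
     {Poly_Mapping.single [v, w] 1 + Poly_Mapping.single [w, v] 1
        - Poly_Mapping.single [] (2 * g v w) |v w. True}"

definition clifford_ideal ::
    "('k::field \<Rightarrow> 'v::ab_group_add \<Rightarrow> 'v) \<Rightarrow> ('v \<Rightarrow> 'v \<Rightarrow> 'k) \<Rightarrow> ('v list \<Rightarrow>\<^sub>0 'k) set" where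
  "clifford_ideal scale g = Idl\<^bsub>free_algebra\<^esub> (clifford_relations scale g)"

definition clifford_algebra ::
    "('k::field \<Rightarrow> 'v::ab_group_add \<Rightarrow> 'v) \<Rightarrow> ('v \<Rightarrow> 'v \<Rightarrow> 'k) \<Rightarrow> ('v, 'k) clifford ring" where
  "clifford_algebra scale g = free_algebra Quot (clifford_ideal scale g)"

definition clifford_vector ::
    "('k::field \<Rightarrow> 'v::ab_group_add \<Rightarrow> 'v) \<Rightarrow> ('v \<Rightarrow> 'v \<Rightarrow> 'k) \<Rightarrow> 'v \<Rightarrow> ('v, 'k) clifford" where
  "clifford_vector scale g v =
     clifford_ideal scale g +>\<^bsub>free_algebra\<^esub> Poly_Mapping.single [v] 1"

definition clifford_scalar ::
    "('k::field \<Rightarrow> 'v::ab_group_add \<Rightarrow> 'v) \<Rightarrow> ('v \<Rightarrow> 'v \<Rightarrow> 'k) \<Rightarrow> 'k \<Rightarrow> ('v, 'k) clifford" where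
  "clifford_scalar scale g c =
     clifford_ideal scale g +>\<^bsub>free_algebra\<^esub> Poly_Mapping.single [] c"

definition clifford_scale ::
    "('k::field \<Rightarrow> 'v::ab_group_add \<Rightarrow> 'v) \<Rightarrow> ('v \<Rightarrow> 'v \<Rightarrow> 'k) \<Rightarrow> 'k \<Rightarrow>
      ('v, 'k) clifford \<Rightarrow> ('v, 'k) clifford" where
  "clifford_scale scale g c x = clifford_scalar scale g c \<otimes>\<^bsub>clifford_algebra scale g\<^esub> x"

definition clifford_product ::
    "('k::field \<Rightarrow> 'v::ab_group_add \<Rightarrow> 'v) \<Rightarrow> ('v \<Rightarrow> 'v \<Rightarrow> 'k) \<Rightarrow> 'v list \<Rightarrow> ('v, 'k) clifford" where
  "clifford_product scale g vs =
     foldr (\<lambda>v c. clifford_vector scale g v \<otimes>\<^bsub>clifford_algebra scale g\<^esub> c) vs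
       \<one>\<^bsub>clifford_algebra scale g\<^esub>"

definition clifford2 ::
    "('k::field \<Rightarrow> 'v::ab_group_add \<Rightarrow> 'v) \<Rightarrow> ('v \<Rightarrow> 'v \<Rightarrow> 'k) \<Rightarrow> nat \<Rightarrow> (nat \<Rightarrow> 'v) \<Rightarrow>
      ('v, 'k) clifford set" where
  "clifford2 scale g N x =
     {\<Oplus>\<^bsub>clifford_algebra scale g\<^esub>p\<in>{(i, j). 1 \<le> i \<and> i < j \<and> j \<le> N}.
        clifford_scale scale g (c p) (clifford_product scale g [x (fst p), x (snd p)]) |c. True}"

section \<open>Spinors\<close>

definition endomorphism_ring ::
    "('k::field \<Rightarrow> 's::ab_group_add \<Rightarrow> 's) \<Rightarrow> ('s \<Rightarrow> 's) ring" where
  "endomorphism_ring scale =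
     \<lparr>carrier = {f. Vector_Spaces.linear scale scale f}, mult = (\<circ>), one = id,
      zero = (\<lambda>_. 0), add = (\<lambda>f h x. f x + h x)\<rparr>"

text \<open>An isomorphism of \<open>'k\<close>-algebras from the Clifford algebra onto the endomorphisms of the
  spinor space: a ring isomorphism compatible with the scalars.\<close>

definition spinor_representation ::
    "('k::field \<Rightarrow> 'v::ab_group_add \<Rightarrow> 'v) \<Rightarrow> ('v \<Rightarrow> 'v \<Rightarrow> 'k) \<Rightarrow>
     ('k \<Rightarrow> 's::ab_group_add \<Rightarrow> 's) \<Rightarrow> (('v, 'k) clifford \<Rightarrow> 's \<Rightarrow> 's) \<Rightarrow> bool" where
  "spinor_representation scaleV g scaleS \<rho> \<longleftrightarrow>
     \<rho> \<in> ring_iso (clifford_algebra scaleV g) (endomorphism_ring scaleS) \<and>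
     (\<forall>c. \<rho> (clifford_scalar scaleV g c) = scaleS c)"

definition spinor_norm ::
    "('k::field \<Rightarrow> 'v::ab_group_add \<Rightarrow> 'v) \<Rightarrow> ('v \<Rightarrow> 'v \<Rightarrow> 'k) \<Rightarrow>
     ('k \<Rightarrow> 's::ab_group_add \<Rightarrow> 's) \<Rightarrow> (('v, 'k) clifford \<Rightarrow> 's \<Rightarrow> 's) \<Rightarrow>
     ('s \<Rightarrow> 's \<Rightarrow> 'k) \<Rightarrow> bool" where
  "spinor_norm scaleV g scaleS \<rho> B \<longleftrightarrow>
     bilinear_map scaleS B \<and>
     (\<forall>v \<phi> \<psi>. B (\<rho> (clifford_vector scaleV g v) \<phi>) \<psi> = B \<phi> (\<rho> (clifford_vector scaleV g v) \<psi>))"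

definition pure_spinor ::
    "('k::field \<Rightarrow> 'v::ab_group_add \<Rightarrow> 'v) \<Rightarrow> ('v \<Rightarrow> 'v \<Rightarrow> 'k) \<Rightarrow>
     (('v, 'k) clifford \<Rightarrow> 's::ab_group_add \<Rightarrow> 's) \<Rightarrow> nat \<Rightarrow> (nat \<Rightarrow> 'v) \<Rightarrow> 's \<Rightarrow> bool" where
  "pure_spinor scaleV g \<rho> n i \<v> \<longleftrightarrow>
     \<v> \<noteq> 0 \<and> (\<forall>a\<in>{1..n}. \<rho> (clifford_vector scaleV g (i a)) \<v> = 0)"

text \<open>The map \<open>L\<^sub>2\<close> (with tilde), with the orthonormal basis \<open>x\<close> as a parameter; its value does not
  depend on the choice of \<open>x\<close>.\<close>

definition spinor_L2 ::
    "('k::field \<Rightarrow> 'v::ab_group_add \<Rightarrow> 'v) \<Rightarrow> ('v \<Rightarrow> 'v \<Rightarrow> 'k) \<Rightarrow>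
     (('v, 'k) clifford \<Rightarrow> 's \<Rightarrow> 's) \<Rightarrow> ('s \<Rightarrow> 's \<Rightarrow> 'k) \<Rightarrow>
     nat \<Rightarrow> (nat \<Rightarrow> 'v) \<Rightarrow> 's \<Rightarrow> 's \<Rightarrow> ('v, 'k) clifford" where
  "spinor_L2 scaleV g \<rho> B N x \<phi> \<psi> =
     clifford_scale scaleV g (1 / 2)
      (\<Oplus>\<^bsub>clifford_algebra scaleV g\<^esub>p\<in>{(i, j). 1 \<le> i \<and> i < j \<and> j \<le> N}.
        (case p of (i, j) \<Rightarrow>
          clifford_scale scaleV g
            (g (x i) (x i) * g (x j) (x j) *
               B \<phi> (\<rho> (clifford_product scaleV g [x j, x i]) \<psi>))
            (clifford_product scaleV g [x i, x j])))"

text \<open>Ordered subsets of \<open>{1..n}\<close> are repetition-free lists.\<close>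

definition ordered_subset :: "nat \<Rightarrow> nat list \<Rightarrow> bool" where
  "ordered_subset n K \<longleftrightarrow> distinct K \<and> set K \<subseteq> {1..n}"

section \<open>Basic facts\<close>

lemma ring_free_algebra: "ring (free_algebra :: ('v list \<Rightarrow>\<^sub>0 'k::field) ring)"
proof -
  have "\<exists>y. y + x = 0 \<and> x + y = 0" for x :: "'v list \<Rightarrow>\<^sub>0 'k"
    by (rule exI[of _ "- x"]) simp
  then show ?thesis
    by unfold_locales
      (auto simp: free_algebra_def Units_def algebra_simps)
qed

lemma ideal_clifford_ideal: "ideal (clifford_ideal scale g) free_algebra"
  unfolding clifford_ideal_def
  by (rule ring.genideal_ideal[OF ring_free_algebra]) (simp add: free_algebra_def)

lemma ring_clifford_algebra: "ring (clifford_algebra scale g)"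
  unfolding clifford_algebra_def by (rule ideal.quotient_is_ring[OF ideal_clifford_ideal])

lemma clifford_coset_hom:
  "(+>\<^bsub>free_algebra\<^esub>) (clifford_ideal scale g) \<in> ring_hom free_algebra (clifford_algebra scale g)"
  unfolding clifford_algebra_def by (rule ideal.rcos_ring_hom[OF ideal_clifford_ideal])

lemma clifford_vector_closed [simp]:
  "clifford_vector scale g v \<in> carrier (clifford_algebra scale g)"
  unfolding clifford_vector_def
  by (rule ring_hom_closed[OF clifford_coset_hom]) (simp add: free_algebra_def)

lemma clifford_scalar_closed [simp]:
  "clifford_scalar scale g c \<in> carrier (clifford_algebra scale g)"
  unfolding clifford_scalar_def
  by (rule ring_hom_closed[OF clifford_coset_hom]) (simp add: free_algebra_def)

lemma clifford_product_closed [simp]: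
  "clifford_product scale g vs \<in> carrier (clifford_algebra scale g)"
proof -
  interpret C: ring "clifford_algebra scale g" by (rule ring_clifford_algebra)
  show ?thesis by (induction vs) (simp_all add: clifford_product_def)
qed

lemma clifford_scale_closed [simp]:
  "a \<in> carrier (clifford_algebra scale g) \<Longrightarrow>
   clifford_scale scale g c a \<in> carrier (clifford_algebra scale g)"
proof -
  interpret C: ring "clifford_algebra scale g" by (rule ring_clifford_algebra)
  show "a \<in> carrier (clifford_algebra scale g) \<Longrightarrow> ?thesis" by (simp add: clifford_scale_def)
qed

lemma clifford_coset_eqI:
  assumes "p - q \<in> clifford_ideal scale g"
  shows "clifford_ideal scale g +>\<^bsub>free_algebra\<^esub> p = clifford_ideal scale g +>\<^bsub>free_algebra\<^esub> q"
proof -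
  interpret F: ring free_algebra by (rule ring_free_algebra)
  interpret I: ideal "clifford_ideal scale g" free_algebra by (rule ideal_clifford_ideal)
  have "p \<in> clifford_ideal scale g +>\<^bsub>free_algebra\<^esub> q"
    unfolding a_r_coset_def r_coset_def using assms
    by (auto simp: free_algebra_def intro!: bexI[of _ "p - q"])
  then show ?thesis
    using F.a_repr_independence[of p _ q] I.a_subgroup by (simp add: free_algebra_def)
qed

lemma clifford_relations_subset: "clifford_relations scale g \<subseteq> clifford_ideal scale g"
  unfolding clifford_ideal_def
  by (rule ring.genideal_self[OF ring_free_algebra]) (simp add: free_algebra_def)

lemma clifford_vector_mult:
  "clifford_vector scale g v \<otimes>\<^bsub>clifford_algebra scale g\<^esub> clifford_vector scale g w =
   clifford_ideal scale g +>\<^bsub>free_algebra\<^esub> Poly_Mapping.single [v, w] 1"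
  unfolding clifford_vector_def
  using ring_hom_mult[OF clifford_coset_hom, of "Poly_Mapping.single [v] 1"
      "Poly_Mapping.single [w] 1" scale g]
  by (simp add: free_algebra_def Poly_Mapping.mult_single plus_list_def)

lemma clifford_relation:
  "clifford_vector scale g v \<otimes>\<^bsub>clifford_algebra scale g\<^esub> clifford_vector scale g w
     \<oplus>\<^bsub>clifford_algebra scale g\<^esub>
   clifford_vector scale g w \<otimes>\<^bsub>clifford_algebra scale g\<^esub> clifford_vector scale g v =
   clifford_scalar scale g (2 * g v w)"
proof -
  have "(clifford_ideal scale g +>\<^bsub>free_algebra\<^esub> Poly_Mapping.single [v, w] 1)
          \<oplus>\<^bsub>clifford_algebra scale g\<^esub>
        (clifford_ideal scale g +>\<^bsub>free_algebra\<^esub> Poly_Mapping.single [w, v] 1) =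
        clifford_ideal scale g +>\<^bsub>free_algebra\<^esub>
          (Poly_Mapping.single [v, w] 1 + Poly_Mapping.single [w, v] 1)"
    using ring_hom_add[OF clifford_coset_hom, of "Poly_Mapping.single [v, w] 1"
        "Poly_Mapping.single [w, v] 1" scale g]
    by (simp add: free_algebra_def)
  also have "\<dots> = clifford_scalar scale g (2 * g v w)"
    unfolding clifford_scalar_def
    by (rule clifford_coset_eqI, rule subsetD[OF clifford_relations_subset])
      (auto simp: clifford_relations_def)
  finally show ?thesis by (simp add: clifford_vector_mult)
qed

lemma clifford_scale_scale:
  assumes "a \<in> carrier (clifford_algebra scale g)"
  shows "clifford_scale scale g c (clifford_scale scale g d a) = clifford_scale scale g (c * d) a"
proof -
  interpret C: ring "clifford_algebra scale g" by (rule ring_clifford_algebra)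
  have "clifford_scalar scale g (c * d) =
        clifford_scalar scale g c \<otimes>\<^bsub>clifford_algebra scale g\<^esub> clifford_scalar scale g d"
    unfolding clifford_scalar_def
    using ring_hom_mult[OF clifford_coset_hom, of "Poly_Mapping.single [] c"
        "Poly_Mapping.single [] d" scale g]
    by (simp add: free_algebra_def Poly_Mapping.mult_single plus_list_def)
  then show ?thesis using assms by (simp add: clifford_scale_def C.m_assoc)
qed

lemma spinor_L2_in_clifford2: "spinor_L2 scaleV g \<rho> B N x \<phi> \<psi> \<in> clifford2 scaleV g N x"
proof -
  interpret C: ring "clifford_algebra scaleV g" by (rule ring_clifford_algebra)
  let ?P = "{(i, j). 1 \<le> i \<and> i < j \<and> j \<le> N}"
  let ?c = "\<lambda>p. g (x (fst p)) (x (fst p)) * g (x (snd p)) (x (snd p)) *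
               B \<phi> (\<rho> (clifford_product scaleV g [x (snd p), x (fst p)]) \<psi>)"
  let ?m = "\<lambda>p. clifford_product scaleV g [x (fst p), x (snd p)]"
  have fin: "finite ?P"
    by (rule finite_subset[of _ "{1..N} \<times> {1..N}"]) auto
  have "spinor_L2 scaleV g \<rho> B N x \<phi> \<psi> =
      clifford_scale scaleV g (1 / 2)
        (\<Oplus>\<^bsub>clifford_algebra scaleV g\<^esub>p\<in>?P. clifford_scale scaleV g (?c p) (?m p))"
    unfolding spinor_L2_def by (simp add: case_prod_unfold)
  also have "\<dots> = (\<Oplus>\<^bsub>clifford_algebra scaleV g\<^esub>p\<in>?P.
      clifford_scale scaleV g (1 / 2) (clifford_scale scaleV g (?c p) (?m p)))"
    unfolding clifford_scale_def[of scaleV g "1 / 2"]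
    by (rule C.finsum_rdistr[OF fin]) auto
  also have "\<dots> = (\<Oplus>\<^bsub>clifford_algebra scaleV g\<^esub>p\<in>?P.
      clifford_scale scaleV g (1 / 2 * ?c p) (?m p))"
    by (rule C.finsum_cong') (auto simp: clifford_scale_scale)
  finally show ?thesis unfolding clifford2_def mem_Collect_eq
    by (intro exI[of _ "\<lambda>p. 1 / 2 * ?c p"] conjI TrueI)
qed

end

theory Submission
  imports Defs
begin

text \<open>
  Antisymmetrising the defining sum of the map \<open>L\<^sub>2\<close> turns the sum over \<open>j < k\<close> into a
  quarter of the sum over all pairs \<open>(j, k)\<close>, minus the scalar \<open>n/2 B(\<phi>, \<psi>)\<close>. The full sum
  applies a multilinear expression twice to the Casimir tensor \<open>\<Sum> g(x\<^sub>j, x\<^sub>j) x\<^sub>j \<otimes> x\<^sub>j\<close>, which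
  is the same for every pair of dual bases (\<open>casimir_independent\<close>). Evaluated on the null basis,
  whose dual basis pairs \<open>e\<^sub>a\<close> with \<open>2 i\<^sub>a\<close> and \<open>i\<^sub>a\<close> with \<open>2 e\<^sub>a\<close>, it becomes a sum of four kinds of
  terms, such as \<open>B(i\<^sub>a i\<^sub>b \<phi>, \<psi>) e\<^sub>a e\<^sub>b\<close> (\<open>L2_action_eq_orthonormal_sum\<close>).

  On spinors the \<open>e\<^sub>a\<close> and \<open>i\<^sub>a\<close> are creation and annihilation operators, and \<open>e\<^sub>K v\<close> is the state in
  which exactly the modes in \<open>K\<close> are occupied. Because the spinor norm makes every vector
  self-adjoint, it pairs a state with occupied set \<open>K\<close> only with states whose occupied set is the
  complement of \<open>K\<close> (\<open>pairing_occupied\<close>). A term with two operators moves the occupied set \<open>I\<close> by at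
  most two elements, so it survives only if \<open>J\<close> is the complement of the moved set. That leaves
  exactly the four listed configurations, and in each of them only the stated terms: a pair of
  equal terms in the first three, the diagonal terms in the last, where \<open>e\<^sub>a i\<^sub>a\<close> and \<open>i\<^sub>a e\<^sub>a\<close> are the
  projections onto ``\<open>a\<close> occupied'' and ``\<open>a\<close> empty'' and the sum counts the modes in which \<open>I\<close> and
  \<open>K\<close> differ.

  The surviving coefficients do not vanish: the Clifford algebra acts as all of \<open>End(S)\<close>, so the
  \<open>e\<^sub>K v\<close> span \<open>S\<close> (\<open>span_states\<close>), and nondegeneracy then forces complementary states to pair
  nontrivially (\<open>pairing_state_nonzero\<close>).
\<close>

section \<open>Dual bases and double sums\<close>

text \<open>Pairing with \<open>y' k\<close> reads off the \<open>k\<close>-th coefficient of any combination of the \<open>y j\<close>.\<close>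

lemma dual_family_expansion:
  fixes scale :: "'k::field \<Rightarrow> 'v::ab_group_add \<Rightarrow> 'v"
  assumes g: "\<And>w. Vector_Spaces.linear scale (*) (\<lambda>v. g v w)"
    and "finite A"
    and dual: "\<And>j k. j \<in> A \<Longrightarrow> k \<in> A \<Longrightarrow> g (y j) (y' k) = (if j = k then 1 else 0)"
    and v: "v \<in> module.span scale (y ` A)"
  shows "v = (\<Sum>j\<in>A. scale (g v (y' j)) (y j))"
proof -
  interpret V: vector_space scale
    using g by (simp add: Vector_Spaces.linear_iff)
  show ?thesis
    using v
  proof (induction rule: V.span_induct_alt)
    case base
    have "g 0 w = 0" for w using g[of w] by (metis Vector_Spaces.linear_iff V.scale_zero_left mult_zero_left)
    then show ?case by simp
  next
    case (step c u v)
    then obtain k where k: "k \<in> A" "u = y k" by blast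
    have "g (scale c u + v) w = c * g u w + g v w" for w
      using g[of w] by (simp add: Vector_Spaces.linear_iff)
    then have "(\<Sum>j\<in>A. scale (g (scale c u + v) (y' j)) (y j)) =
        (\<Sum>j\<in>A. scale (c * g u (y' j)) (y j)) + (\<Sum>j\<in>A. scale (g v (y' j)) (y j))"
      by (simp add: V.scale_left_distrib sum.distrib)
    also have "(\<Sum>j\<in>A. scale (c * g u (y' j)) (y j)) = (\<Sum>j\<in>A. if k = j then scale c u else 0)"
      by (rule sum.cong) (auto simp: k dual)
    also have "\<dots> = scale c u"
      using k \<open>finite A\<close> by simp
    finally show ?case using step by simp
  qed
qed

lemma linear_sum_scale:
  assumes "Vector_Spaces.linear s1 s2 f"
  shows "f (\<Sum>j\<in>A. s1 (c j) (y j)) = (\<Sum>j\<in>A. s2 (c j) (f (y j)))"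
proof -
  interpret vector_space_pair s1 s2
    using assms by (simp add: Vector_Spaces.linear_iff vector_space_pair_def)
  show ?thesis by (simp add: linear_sum[OF assms] linear_scale[OF assms])
qed

text \<open>Contraction with the Casimir tensor: expanding one factor of each side in the other pair of
  families gives the same double sum.\<close>

lemma casimir_independent:
  fixes g :: "'v::ab_group_add \<Rightarrow> 'v \<Rightarrow> 'k::field"
  assumes F: "\<And>u. Vector_Spaces.linear sV sS (F u)"
      "\<And>w. Vector_Spaces.linear sV sS (\<lambda>u. F u w)"
    and sym: "\<And>u w. g u w = g w u"
    and y: "\<And>v. v = (\<Sum>j\<in>A. sV (g v (y' j)) (y j))"
    and z: "\<And>v. v = (\<Sum>k\<in>D. sV (g v (z k)) (z' k))"
  shows "(\<Sum>j\<in>A. F (y j) (y' j)) = (\<Sum>k\<in>D. F (z k) (z' k))"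
proof -
  have "(\<Sum>j\<in>A. F (y j) (y' j)) = (\<Sum>j\<in>A. \<Sum>k\<in>D. sS (g (y' j) (z k)) (F (y j) (z' k)))"
    by (subst z, subst linear_sum_scale[OF F(1)]) simp
  also have "\<dots> = (\<Sum>k\<in>D. \<Sum>j\<in>A. sS (g (z k) (y' j)) (F (y j) (z' k)))"
    by (subst sum.swap) (simp only: sym)
  also have "\<dots> = (\<Sum>k\<in>D. F (z k) (z' k))"
    by (subst (2) y, subst linear_sum_scale[OF F(2)]) simp
  finally show ?thesis .
qed

lemma sum_square_symmetric:
  fixes f :: "nat \<Rightarrow> nat \<Rightarrow> 'a::comm_monoid_add" and N :: nat
  assumes sym: "\<And>j k. j \<noteq> k \<Longrightarrow> f j k = f k j"
  defines "P \<equiv> {(j, k). 1 \<le> j \<and> j < k \<and> k \<le> N}"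
  shows "(\<Sum>j\<in>{1..N}. \<Sum>k\<in>{1..N}. f j k) =
    (\<Sum>(j, k)\<in>P. f j k) + (\<Sum>(j, k)\<in>P. f j k) + (\<Sum>j\<in>{1..N}. f j j)"
proof -
  let ?h = "\<lambda>(j, k). f j k"
  have fin: "finite P"
    by (rule finite_subset[of _ "{1..N} \<times> {1..N}"]) (auto simp: P_def)
  have split: "{1..N} \<times> {1..N} = (P \<union> prod.swap ` P) \<union> (\<lambda>j. (j, j)) ` {1..N}"
    by (auto simp: P_def image_iff)
  have "(\<Sum>j\<in>{1..N}. \<Sum>k\<in>{1..N}. f j k) = sum ?h ({1..N} \<times> {1..N})"
    by (rule sum.cartesian_product)
  also have "\<dots> = sum ?h (P \<union> prod.swap ` P) + sum ?h ((\<lambda>j. (j, j)) ` {1..N})"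
    unfolding split by (rule sum.union_disjoint) (use fin in \<open>auto simp: P_def\<close>)
  also have "sum ?h (P \<union> prod.swap ` P) = sum ?h P + sum ?h (prod.swap ` P)"
    by (rule sum.union_disjoint) (use fin in \<open>auto simp: P_def\<close>)
  also have "sum ?h (prod.swap ` P) = sum ?h P"
    by (subst sum.reindex) (auto simp: P_def inj_on_def intro!: sum.cong sym)
  also have "sum ?h ((\<lambda>j. (j, j)) ` {1..N}) = (\<Sum>j\<in>{1..N}. f j j)"
    by (subst sum.reindex) (auto simp: inj_on_def)
  finally show ?thesis .
qed

lemma sum_two_terms:
  fixes f :: "'b \<Rightarrow> 'b \<Rightarrow> 'a::comm_monoid_add"
  assumes "finite A" "a \<in> A" "b \<in> A" "a \<noteq> b"
    and "\<And>c d. c \<in> A \<Longrightarrow> d \<in> A \<Longrightarrow> c \<noteq> d \<and> {c, d} = {a, b} \<or> f c d = 0"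
  shows "(\<Sum>c\<in>A. \<Sum>d\<in>A. f c d) = f a b + f b a"
proof -
  have "(\<Sum>c\<in>A. \<Sum>d\<in>A. f c d) = (\<Sum>(c, d)\<in>A \<times> A. f c d)"
    by (rule sum.cartesian_product)
  also have "\<dots> = (\<Sum>(c, d)\<in>{(a, b), (b, a)}. f c d)"
  proof (rule sum.mono_neutral_right)
    show "\<forall>p\<in>A \<times> A - {(a, b), (b, a)}. (case p of (c, d) \<Rightarrow> f c d) = 0"
      using assms(5) by (fastforce simp: doubleton_eq_iff)
  qed (use assms in auto)
  finally show ?thesis using assms(4) by simp
qed

section \<open>The Clifford algebra acting on spinors\<close>

lemma clifford_vector_linear:
  shows "clifford_vector scale g (v + w) =
      clifford_vector scale g v \<oplus>\<^bsub>clifford_algebra scale g\<^esub> clifford_vector scale g w"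
    and "clifford_vector scale g (scale c v) = clifford_scale scale g c (clifford_vector scale g v)"
proof -
  let ?q = "\<lambda>p. clifford_ideal scale g +>\<^bsub>free_algebra\<^esub> p"
  have "clifford_vector scale g (v + w) =
      ?q (Poly_Mapping.single [v] 1 + Poly_Mapping.single [w] 1)"
    unfolding clifford_vector_def
    by (rule clifford_coset_eqI, rule subsetD[OF clifford_relations_subset])
      (auto simp: clifford_relations_def diff_diff_eq)
  then show "clifford_vector scale g (v + w) =
      clifford_vector scale g v \<oplus>\<^bsub>clifford_algebra scale g\<^esub> clifford_vector scale g w"
    using ring_hom_add[OF clifford_coset_hom, of "Poly_Mapping.single [v] 1"
        "Poly_Mapping.single [w] 1" scale g]
    by (simp add: free_algebra_def clifford_vector_def)
  have "clifford_vector scale g (scale c v) = ?q (Poly_Mapping.single [v] c)"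
    unfolding clifford_vector_def
    by (rule clifford_coset_eqI, rule subsetD[OF clifford_relations_subset])
      (auto simp: clifford_relations_def)
  then show "clifford_vector scale g (scale c v) = clifford_scale scale g c (clifford_vector scale g v)"
    using ring_hom_mult[OF clifford_coset_hom, of "Poly_Mapping.single [] c"
        "Poly_Mapping.single [v] 1" scale g]
    by (simp add: free_algebra_def clifford_scale_def clifford_scalar_def clifford_vector_def
        Poly_Mapping.mult_single plus_list_def)
qed

lemma spinor_representation_hom:
  assumes "spinor_representation scaleV g scaleS \<rho>"
    and "x \<in> carrier (clifford_algebra scaleV g)" "y \<in> carrier (clifford_algebra scaleV g)"
  shows "\<rho> (x \<oplus>\<^bsub>clifford_algebra scaleV g\<^esub> y) s = \<rho> x s + \<rho> y s"
    and "\<rho> (x \<otimes>\<^bsub>clifford_algebra scaleV g\<^esub> y) s = \<rho> x (\<rho> y s)"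
    and "\<rho> \<one>\<^bsub>clifford_algebra scaleV g\<^esub> s = s"
    and "\<rho> (clifford_scalar scaleV g c) s = scaleS c s"
    and "\<rho> (clifford_scale scaleV g c x) s = scaleS c (\<rho> x s)"
    and "Vector_Spaces.linear scaleS scaleS (\<rho> x)"
proof -
  have h: "\<rho> \<in> ring_hom (clifford_algebra scaleV g) (endomorphism_ring scaleS)"
    and c: "\<And>c. \<rho> (clifford_scalar scaleV g c) = scaleS c"
    using assms(1) by (auto simp: spinor_representation_def ring_iso_def)
  note m = ring_hom_mult[OF h]
  show "\<rho> (x \<oplus>\<^bsub>clifford_algebra scaleV g\<^esub> y) s = \<rho> x s + \<rho> y s"
    using ring_hom_add[OF h assms(2,3)] by (simp add: endomorphism_ring_def)
  show "\<rho> (x \<otimes>\<^bsub>clifford_algebra scaleV g\<^esub> y) s = \<rho> x (\<rho> y s)"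
    using m[OF assms(2,3)] by (simp add: endomorphism_ring_def)
  show "\<rho> \<one>\<^bsub>clifford_algebra scaleV g\<^esub> s = s"
    using ring_hom_one[OF h] by (simp add: endomorphism_ring_def)
  show "\<rho> (clifford_scalar scaleV g c) s = scaleS c s"
    by (simp add: c)
  show "\<rho> (clifford_scale scaleV g c x) s = scaleS c (\<rho> x s)"
    using m[OF _ assms(2), of "clifford_scalar scaleV g c"]
    by (simp add: clifford_scale_def c endomorphism_ring_def)
  show "Vector_Spaces.linear scaleS scaleS (\<rho> x)"
    using ring_hom_closed[OF h assms(2)] by (simp add: endomorphism_ring_def)
qed

lemma spinor_representation_product:
  assumes "spinor_representation scaleV g scaleS \<rho>"
  shows "\<rho> (clifford_product scaleV g vs) s = foldr (\<lambda>v. \<rho> (clifford_vector scaleV g v)) vs s"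
proof (induction vs)
  case Nil
  show ?case
    using spinor_representation_hom(3)[OF assms clifford_vector_closed clifford_vector_closed]
    by (simp add: clifford_product_def)
next
  case (Cons v vs)
  have "clifford_product scaleV g (v # vs) =
      clifford_vector scaleV g v \<otimes>\<^bsub>clifford_algebra scaleV g\<^esub> clifford_product scaleV g vs"
    by (simp add: clifford_product_def)
  then show ?case
    using Cons spinor_representation_hom(2)[OF assms clifford_vector_closed clifford_product_closed]
    by simp
qed

lemma spinor_representation_finsum:
  assumes \<rho>: "spinor_representation scaleV g scaleS \<rho>"
    and "finite P" and f: "\<And>p. p \<in> P \<Longrightarrow> f p \<in> carrier (clifford_algebra scaleV g)"
  shows "\<rho> (\<Oplus>\<^bsub>clifford_algebra scaleV g\<^esub>p\<in>P. f p) s = (\<Sum>p\<in>P. \<rho> (f p) s)"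
proof -
  interpret C: ring "clifford_algebra scaleV g" by (rule ring_clifford_algebra)
  have zero: "\<rho> \<zero>\<^bsub>clifford_algebra scaleV g\<^esub> s = 0"
    using spinor_representation_hom(1)[OF \<rho> C.zero_closed C.zero_closed, of s] by simp
  show ?thesis
    using assms(2) f
    by (induction P rule: finite_induct) (simp_all add: zero spinor_representation_hom(1)[OF \<rho>] Pi_def)
qed

text \<open>Every element is the class of a finite combination of words, so products of vectors
  generate the Clifford algebra additively, up to scalars.\<close>

lemma clifford_algebra_induct [consumes 1, case_names word add]:
  fixes scale :: "'k::field \<Rightarrow> 'v::ab_group_add \<Rightarrow> 'v"
  assumes "z \<in> carrier (clifford_algebra scale g)"
    and word: "\<And>c vs. P (clifford_scale scale g c (clifford_product scale g vs))"
    and add: "\<And>x y. x \<in> carrier (clifford_algebra scale g) \<Longrightarrow> 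
      y \<in> carrier (clifford_algebra scale g) \<Longrightarrow> P x \<Longrightarrow> P y \<Longrightarrow>
      P (x \<oplus>\<^bsub>clifford_algebra scale g\<^esub> y)"
  shows "P z"
proof -
  let ?q = "\<lambda>p. clifford_ideal scale g +>\<^bsub>free_algebra\<^esub> p"
  have closed: "?q p \<in> carrier (clifford_algebra scale g)" for p
    by (rule ring_hom_closed[OF clifford_coset_hom]) (simp add: free_algebra_def)
  have hom: "?q (p + r) = ?q p \<oplus>\<^bsub>clifford_algebra scale g\<^esub> ?q r"
      "?q (p * r) = ?q p \<otimes>\<^bsub>clifford_algebra scale g\<^esub> ?q r"
      "?q 1 = \<one>\<^bsub>clifford_algebra scale g\<^esub>" for p r
    using ring_hom_add[OF clifford_coset_hom, of p r scale g]
      ring_hom_mult[OF clifford_coset_hom, of p r scale g]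
      ring_hom_one[OF clifford_coset_hom, of scale g]
    by (simp_all add: free_algebra_def)
  have one: "?q (Poly_Mapping.single vs 1) = clifford_product scale g vs" for vs
  proof (induction vs)
    case Nil
    then show ?case using hom(3)
      by (simp add: clifford_product_def single_one[symmetric] zero_list_def)
  next
    case (Cons v vs)
    have "Poly_Mapping.single (v # vs) (1::'k) = Poly_Mapping.single [v] 1 * Poly_Mapping.single vs 1"
      by (simp add: Poly_Mapping.mult_single plus_list_def)
    with Cons show ?case
      by (simp add: hom(2) clifford_product_def clifford_vector_def)
  qed
  have single: "P (?q (Poly_Mapping.single vs c))" for vs c
  proof -
    have "Poly_Mapping.single vs c = Poly_Mapping.single [] c * Poly_Mapping.single vs 1"
      by (simp add: Poly_Mapping.mult_single plus_list_def)
    then have "?q (Poly_Mapping.single vs c) = clifford_scale scale g c (clifford_product scale g vs)"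
      by (simp add: hom(2) one clifford_scale_def clifford_scalar_def)
    then show ?thesis using word by simp
  qed
  have "P (?q p)" for p
  proof (induction p rule: update_induct)
    case const
    show ?case using single[of "[]" 0] by simp
  next
    case (update f vs c)
    have "Poly_Mapping.update vs c f = f + Poly_Mapping.single vs c"
      using update(1)
      by (intro poly_mapping_eqI) (auto simp: lookup_update lookup_add lookup_single in_keys_iff when_def)
    then show ?case using update(3) by (simp add: hom(1) add closed single)
  qed
  moreover obtain p where "z = ?q p"
    using assms(1)
    by (auto simp: clifford_algebra_def FactRing_def A_RCOSETS_def RCOSETS_def a_r_coset_def free_algebra_def)
  ultimately show ?thesis by simp
qed

text \<open>A subspace that is stable under vectors is stable under the whole algebra, which acts as
  \<open>End(S)\<close>; and some endomorphism carries a given nonzero spinor to any other.\<close>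

lemma spinor_representation_irreducible:
  assumes \<rho>: "spinor_representation scaleV g scaleS \<rho>"
    and W: "module.subspace scaleS W"
    and inv: "\<And>v s. s \<in> W \<Longrightarrow> \<rho> (clifford_vector scaleV g v) s \<in> W"
    and w: "w \<in> W" "w \<noteq> 0"
  shows "W = UNIV"
proof -
  interpret S: vector_space scaleS
    using spinor_representation_hom(6)[OF \<rho> clifford_vector_closed clifford_vector_closed]
    by (simp add: Vector_Spaces.linear_iff)
  interpret SS: vector_space_pair scaleS scaleS ..
  have prod: "\<rho> (clifford_product scaleV g vs) w \<in> W" for vs
    unfolding spinor_representation_product[OF \<rho>]
    by (induction vs) (simp_all add: w inv)
  have all: "\<rho> z w \<in> W" if "z \<in> carrier (clifford_algebra scaleV g)" for z
    using that
  proof (induction rule: clifford_algebra_induct)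
    case (word c vs)
    then show ?case
      using prod spinor_representation_hom(5)[OF \<rho> clifford_product_closed clifford_product_closed]
        S.subspace_scale[OF W] by simp
  next
    case (add x y)
    then show ?case
      using spinor_representation_hom(1)[OF \<rho>] S.subspace_add[OF W] by simp
  qed
  have "s \<in> W" for s
  proof -
    have "S.independent {w}" using w by simp
    then obtain f where f: "Vector_Spaces.linear scaleS scaleS f" "f w = s"
      using SS.linear_independent_extend[of "{w}" "\<lambda>_. s"] by auto
    have "f \<in> \<rho> ` carrier (clifford_algebra scaleV g)"
      using \<rho> f(1)
      by (simp add: spinor_representation_def ring_iso_def bij_betw_def endomorphism_ring_def)
    then show ?thesis using all f(2) by auto
  qed
  then show ?thesis by auto
qed

section \<open>Creation and annihilation operators\<close>

text \<open>The argument sees the Clifford algebra only through the action \<open>v \<cdot> s\<close> of vectors on spinors,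
  together with irreducibility. The vacuum \<open>vac\<close> is the pure spinor, annihilated by every \<open>i a\<close>;
  \<open>null_expansion\<close> says that \<open>e\<close> and \<open>i\<close> jointly span, with the coefficients that their mutual pairing
  \<open>1/2\<close> forces.\<close>

locale spinor_fock =
  V: vector_space scaleV + S: vector_space scaleS
  for scaleV :: "'k::field \<Rightarrow> 'v::ab_group_add \<Rightarrow> 'v"
    and scaleS :: "'k \<Rightarrow> 's::ab_group_add \<Rightarrow> 's"  (infixr \<open>*s\<close> 75) +
  fixes g :: "'v \<Rightarrow> 'v \<Rightarrow> 'k"
    and act :: "'v \<Rightarrow> 's \<Rightarrow> 's"  (infixr \<open>\<cdot>\<close> 75)
    and B :: "'s \<Rightarrow> 's \<Rightarrow> 'k"
    and n :: nat
    and i e :: "nat \<Rightarrow> 'v"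
    and vac :: 's
  assumes two: "(2::'k) \<noteq> 0"
    and act_linear: "Vector_Spaces.linear scaleS scaleS ((\<cdot>) v)"
      "Vector_Spaces.linear scaleV scaleS (\<lambda>v. v \<cdot> s)"
    and clifford: "v \<cdot> w \<cdot> s + w \<cdot> v \<cdot> s = (2 * g v w) *s s"
    and irreducible: "S.subspace W \<Longrightarrow> (\<And>v s. s \<in> W \<Longrightarrow> v \<cdot> s \<in> W) \<Longrightarrow> s \<in> W \<Longrightarrow> s \<noteq> 0 \<Longrightarrow> W = UNIV"
    and B_bilinear: "bilinear_map scaleS B"
    and B_adjoint: "B (v \<cdot> \<phi>) \<psi> = B \<phi> (v \<cdot> \<psi>)"
    and B_nondegenerate: "nondegenerate B"
    and g_sym: "g v w = g w v"
    and e_isotropic: "a \<in> {1..n} \<Longrightarrow> b \<in> {1..n} \<Longrightarrow> g (e a) (e b) = 0"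
    and i_isotropic: "a \<in> {1..n} \<Longrightarrow> b \<in> {1..n} \<Longrightarrow> g (i a) (i b) = 0"
    and e_i: "a \<in> {1..n} \<Longrightarrow> b \<in> {1..n} \<Longrightarrow> g (e a) (i b) = (if a = b then 1 / 2 else 0)"
    and null_expansion: "v = (\<Sum>a\<in>{1..n}. scaleV (2 * g v (i a)) (e a)) +
      (\<Sum>a\<in>{1..n}. scaleV (2 * g v (e a)) (i a))"
    and vac_nonzero: "vac \<noteq> 0"
    and i_vac: "a \<in> {1..n} \<Longrightarrow> i a \<cdot> vac = 0"
begin

lemma act_simps [simp]:
  "v \<cdot> (s + t) = v \<cdot> s + v \<cdot> t" "v \<cdot> (c *s s) = c *s (v \<cdot> s)"
  "(v + w) \<cdot> s = v \<cdot> s + w \<cdot> s" "scaleV c v \<cdot> s = c *s (v \<cdot> s)"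
  using act_linear by (simp_all add: Vector_Spaces.linear_iff)

lemma act_zero_minus [simp]: "v \<cdot> 0 = 0" "v \<cdot> (- s) = - (v \<cdot> s)"
proof -
  show "v \<cdot> 0 = 0" using act_simps(2)[of v 0 0] by simp
  show "v \<cdot> (- s) = - (v \<cdot> s)" using act_simps(2)[of v "-1" s] by simp
qed

lemma B_simps [simp]:
  "B (s + t) u = B s u + B t u" "B (c *s s) u = c * B s u"
  "B s (t + u) = B s t + B s u" "B s (c *s u) = c * B s u"
  using B_bilinear by (simp_all add: bilinear_map_def Vector_Spaces.linear_iff)

lemma B_zero [simp]: "B 0 u = 0" "B s 0 = 0" "B (- s) u = - B s u" "B s (- u) = - B s u"
  using B_simps(2)[of 0 0 u] B_simps(4)[of s 0 0] B_simps(2)[of "-1" s u] B_simps(4)[of s "-1" u]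
  by simp_all

lemma act_swap: "v \<cdot> w \<cdot> s = (2 * g v w) *s s - w \<cdot> v \<cdot> s"
  using clifford[of v w s] by (simp add: algebra_simps)

lemma anticommute:
  assumes "a \<in> {1..n}" "b \<in> {1..n}"
  shows "e a \<cdot> e b \<cdot> s = - (e b \<cdot> e a \<cdot> s)" "i a \<cdot> i b \<cdot> s = - (i b \<cdot> i a \<cdot> s)"
    and "a \<noteq> b \<Longrightarrow> i a \<cdot> e b \<cdot> s = - (e b \<cdot> i a \<cdot> s)"
    and "a \<noteq> b \<Longrightarrow> e a \<cdot> i b \<cdot> s = - (i b \<cdot> e a \<cdot> s)"
    and "i a \<cdot> e a \<cdot> s = s - e a \<cdot> i a \<cdot> s"
  using assms two act_swap[of "e a" "e b" s] act_swap[of "i a" "i b" s]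
    act_swap[of "i a" "e b" s] act_swap[of "e a" "i b" s] act_swap[of "i a" "e a" s]
    g_sym[of "i a" "e b"] g_sym[of "i a" "e a"]
  by (simp_all add: e_isotropic i_isotropic e_i)

lemma act_twice:
  assumes "a \<in> {1..n}"
  shows "e a \<cdot> e a \<cdot> s = 0" "i a \<cdot> i a \<cdot> s = 0"
proof -
  have *: "t = 0" if "t + t = 0" for t :: 's
  proof -
    have "2 *s t = 0" using that S.scale_left_distrib[of 1 1 t] by simp
    then show ?thesis using two by simp
  qed
  show "e a \<cdot> e a \<cdot> s = 0" "i a \<cdot> i a \<cdot> s = 0"
    by (rule *, use clifford[of "e a" "e a" s] clifford[of "i a" "i a" s] assms in \<open>simp add: e_isotropic i_isotropic\<close>)+
qed

text \<open>Occupation is characterised by annihilation alone: a filled mode cannot be filled again and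
  an empty one cannot be emptied. Thus \<open>0\<close> is occupied by every set of modes, so no signs or
  case distinctions arise when a mode is filled or emptied.\<close>

definition occupied :: "nat set \<Rightarrow> 's \<Rightarrow> bool" where
  "occupied A s \<longleftrightarrow> A \<subseteq> {1..n} \<and> (\<forall>a\<in>A. e a \<cdot> s = 0) \<and> (\<forall>a\<in>{1..n} - A. i a \<cdot> s = 0)"

lemma occupied_e:
  assumes "occupied A s" "a \<in> {1..n}"
  shows "occupied (insert a A) (e a \<cdot> s)"
proof -
  have "e b \<cdot> e a \<cdot> s = 0" if "b \<in> insert a A" for b
    using that assms anticommute(1)[OF _ assms(2), of b s] act_twice(1)[of a s]
    by (auto simp: occupied_def)
  moreover have "i b \<cdot> e a \<cdot> s = 0" if "b \<in> {1..n} - insert a A" for b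
    using that assms anticommute(3)[OF _ assms(2), of b s] by (auto simp: occupied_def)
  ultimately show ?thesis using assms by (auto simp: occupied_def)
qed

lemma occupied_i:
  assumes "occupied A s" "a \<in> {1..n}"
  shows "occupied (A - {a}) (i a \<cdot> s)"
proof -
  have "e b \<cdot> i a \<cdot> s = 0" if "b \<in> A - {a}" for b
    using that assms anticommute(4)[OF _ assms(2), of b s] by (auto simp: occupied_def)
  moreover have "i b \<cdot> i a \<cdot> s = 0" if "b \<in> {1..n} - (A - {a})" for b
    using that assms anticommute(2)[OF _ assms(2), of b s] act_twice(2)[of a s]
    by (auto simp: occupied_def)
  ultimately show ?thesis using assms by (auto simp: occupied_def)
qed

text \<open>The projections onto the states in which the mode \<open>a\<close> is filled, respectively empty.\<close>

lemma number_operator: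
  assumes "occupied A s" "a \<in> {1..n}"
  shows "e a \<cdot> i a \<cdot> s = (if a \<in> A then s else 0)"
    and "i a \<cdot> e a \<cdot> s = (if a \<in> A then 0 else s)"
  using assms anticommute(5)[OF assms(2,2), of s] by (auto simp: occupied_def)

text \<open>If \<open>s\<close> and \<open>t\<close> agree on the mode \<open>a\<close>, insert the projection that fixes \<open>t\<close> and move its first
  factor across \<open>B\<close>: it annihilates \<open>s\<close>.\<close>

lemma pairing_occupied:
  assumes s: "occupied A s" and t: "occupied A' t" and nz: "B s t \<noteq> 0"
  shows "A' = {1..n} - A"
proof -
  have "(a \<in> A') \<noteq> (a \<in> A)" if a: "a \<in> {1..n}" for a
  proof
    assume eq: "(a \<in> A') = (a \<in> A)"
    show False
    proof (cases "a \<in> A")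
      case True
      then have "B s t = B s (e a \<cdot> i a \<cdot> t)" using number_operator(1)[OF t a] eq by simp
      also have "\<dots> = B (e a \<cdot> s) (i a \<cdot> t)" by (simp add: B_adjoint)
      finally show False using s True nz by (simp add: occupied_def)
    next
      case False
      then have "B s t = B s (i a \<cdot> e a \<cdot> t)" using number_operator(2)[OF t a] eq by simp
      also have "\<dots> = B (i a \<cdot> s) (e a \<cdot> t)" by (simp add: B_adjoint)
      finally show False using s False nz a by (simp add: occupied_def)
    qed
  qed
  then show ?thesis using s t by (auto simp: occupied_def)
qed

definition state :: "nat list \<Rightarrow> 's" where
  "state K = foldr (\<lambda>a s. e a \<cdot> s) K vac"

lemma state_simps [simp]: "state [] = vac" "state (a # K) = e a \<cdot> state K"
  by (simp_all add: state_def)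

lemma occupied_state: "set K \<subseteq> {1..n} \<Longrightarrow> occupied (set K) (state K)"
  by (induction K) (auto simp: occupied_e i_vac, simp add: occupied_def i_vac)

lemma state_nonzero:
  assumes "distinct K" "set K \<subseteq> {1..n}"
  shows "state K \<noteq> 0"
  using assms
proof (induction K)
  case Nil
  then show ?case by (simp add: vac_nonzero)
next
  case (Cons a K)
  then have "i a \<cdot> e a \<cdot> state K = state K"
    using number_operator(2)[OF occupied_state[of K], of a] by auto
  then show ?case using Cons by auto
qed

text \<open>The span of the states is stable under the \<open>e a\<close> by construction and under the \<open>i a\<close> by moving
  them to the right until they meet the vacuum, so irreducibility applies. Repetitions in \<open>K\<close> are
  allowed because they keep stability under \<open>e a\<close> immediate.\<close>

lemma span_states: "S.span (state ` {K. set K \<subseteq> {1..n}}) = UNIV" (is "?W = _")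
proof (rule irreducible)
  show "S.subspace ?W" by (rule S.subspace_span)
  have span_act: "v \<cdot> s \<in> ?W"
    if gen: "\<And>K. set K \<subseteq> {1..n} \<Longrightarrow> v \<cdot> state K \<in> ?W" and s: "s \<in> ?W" for v s
    using s
  proof (induction rule: S.span_induct_alt)
    case base
    show ?case unfolding act_zero_minus by (rule S.span_zero)
  next
    case (step c t u)
    then obtain K where "set K \<subseteq> {1..n}" "t = state K" by blast
    then have "c *s v \<cdot> t + v \<cdot> u \<in> ?W"
      using gen step by (intro S.span_add S.span_scale) simp_all
    then show ?case unfolding act_simps .
  qed
  have e: "e a \<cdot> s \<in> ?W" if a: "a \<in> {1..n}" and s: "s \<in> ?W" for a s
  proof (rule span_act[OF _ s])
    fix K assume "set K \<subseteq> {1..n}"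
    then have "state (a # K) \<in> ?W" using a by (intro S.span_base imageI) auto
    then show "e a \<cdot> state K \<in> ?W" by simp
  qed
  have i_state: "i a \<cdot> state K \<in> ?W" if "a \<in> {1..n}" "set K \<subseteq> {1..n}" for a K
    using that(2)
  proof (induction K)
    case Nil
    then show ?case using that(1) by (simp add: i_vac S.span_zero)
  next
    case (Cons b K)
    then have "i a \<cdot> state (b # K) = (2 * g (i a) (e b)) *s state K - e b \<cdot> i a \<cdot> state K"
      using act_swap[of "i a" "e b"] by simp
    moreover have "e b \<cdot> i a \<cdot> state K \<in> ?W"
      using Cons by (intro e) auto
    moreover have "state K \<in> ?W"
      using Cons.prems by (intro S.span_base) auto
    ultimately show ?case by (simp only: S.span_diff S.span_scale)
  qed
  have i: "i a \<cdot> s \<in> ?W" if "a \<in> {1..n}" "s \<in> ?W" for a s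
    by (rule span_act) (use that i_state in auto)
  show "v \<cdot> s \<in> ?W" if "s \<in> ?W" for v s
  proof -
    have "v \<cdot> s = (\<Sum>a\<in>{1..n}. (2 * g v (i a)) *s (e a \<cdot> s)) +
        (\<Sum>a\<in>{1..n}. (2 * g v (e a)) *s (i a \<cdot> s))"
      by (subst null_expansion[of v])
        (simp add: linear_sum_scale[OF act_linear(2)])
    then show ?thesis using that e i by (auto intro!: S.span_add S.span_sum S.span_scale)
  qed
  show "vac \<in> ?W" by (rule S.span_base, rule image_eqI[of _ _ "[]"]) auto
  show "vac \<noteq> 0" by (rule vac_nonzero)
qed

text \<open>A completely filled state pairs to zero with all states except the vacuum, so by nondegeneracy
  it cannot also pair to zero with the vacuum.\<close>

lemma pairing_full_vac:
  assumes t: "occupied {1..n} t" "t \<noteq> 0"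
  shows "B t vac \<noteq> 0"
proof
  assume 0: "B t vac = 0"
  have K: "B t (state K) = 0" if "set K \<subseteq> {1..n}" for K
    using pairing_occupied[OF t(1) occupied_state[OF that]] 0 by (cases "K = []") auto
  have "B t s = 0" for s
  proof -
    have "s \<in> S.span (state ` {K. set K \<subseteq> {1..n}})" unfolding span_states by (rule UNIV_I)
    then show ?thesis
      by (induction rule: S.span_induct_alt) (auto simp: K)
  qed
  then show False using t(2) B_nondegenerate by (auto simp: nondegenerate_def)
qed

text \<open>Moving the creation operators of \<open>L\<close> to the other side of \<open>B\<close> fills the remaining modes of \<open>s\<close>
  one by one, until the pairing is that of a full state with the vacuum.\<close>

lemma pairing_state_nonzero:
  assumes "occupied A s" "s \<noteq> 0" "distinct L" "set L = {1..n} - A"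
  shows "B s (state L) \<noteq> 0"
  using assms
proof (induction L arbitrary: A s)
  case Nil
  then have "A = {1..n}" by (auto simp: occupied_def)
  with Nil show ?case using pairing_full_vac by simp
next
  case (Cons a L)
  then have a: "a \<in> {1..n}" "a \<notin> A" by auto
  then have "i a \<cdot> e a \<cdot> s = s" using number_operator(2)[OF Cons.prems(1), of a] by simp
  then have "e a \<cdot> s \<noteq> 0" using Cons.prems(2) by auto
  moreover have "set L = {1..n} - insert a A" using Cons.prems(3,4) by auto
  ultimately have "B (e a \<cdot> s) (state L) \<noteq> 0"
    using Cons.IH[OF occupied_e[OF Cons.prems(1) a(1)]] Cons.prems(3) by simp
  then show ?case by (simp add: B_adjoint)
qed


section \<open>The map in the null basis\<close>

text \<open>The action of the bivector attached to \<open>\<phi>\<close> and \<open>\<psi>\<close> on the spinor \<open>s\<close>, in the null basis. Keeping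
  all ordered pairs \<open>(a, b)\<close>, the diagonal included, leaves the scalar \<open>n/2 B \<phi> \<psi>\<close> as the only correction.\<close>

definition L2_action :: "'s \<Rightarrow> 's \<Rightarrow> 's \<Rightarrow> 's" where
  "L2_action \<phi> \<psi> s = (\<Sum>a\<in>{1..n}. \<Sum>b\<in>{1..n}.
       B (i a \<cdot> i b \<cdot> \<phi>) \<psi> *s e a \<cdot> e b \<cdot> s + B (e a \<cdot> e b \<cdot> \<phi>) \<psi> *s i a \<cdot> i b \<cdot> s
     + B (e a \<cdot> i b \<cdot> \<phi>) \<psi> *s i a \<cdot> e b \<cdot> s + B (i a \<cdot> e b \<cdot> \<phi>) \<psi> *s e a \<cdot> i b \<cdot> s)
     - (of_nat n / 2 * B \<phi> \<psi>) *s s"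

text \<open>Off the diagonal the summand is symmetric in \<open>(j, k)\<close>, both factors changing sign, and on
  the diagonal it equals \<open>B \<phi> \<psi> *s s\<close>. Hence twice the sum over \<open>j < k\<close> is the full double sum
  minus \<open>2n\<close> copies of that; the full sum is evaluated by changing the basis in each index.\<close>

lemma L2_action_eq_orthonormal_sum:
  assumes ortho: "\<And>j k. j \<in> {1..2*n} \<Longrightarrow> k \<in> {1..2*n} \<Longrightarrow> j \<noteq> k \<Longrightarrow> g (x j) (x k) = 0"
    and eps: "\<And>j. j \<in> {1..2*n} \<Longrightarrow> g (x j) (x j) * g (x j) (x j) = 1"
    and expand: "\<And>v. v = (\<Sum>j\<in>{1..2*n}. scaleV (g v (scaleV (g (x j) (x j)) (x j))) (x j))"
  shows "(1 / 2) *s (\<Sum>(j, k)\<in>{(j, k). 1 \<le> j \<and> j < k \<and> k \<le> 2*n}.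
      (g (x j) (x j) * g (x k) (x k) * B \<phi> (x k \<cdot> x j \<cdot> \<psi>)) *s (x j \<cdot> x k \<cdot> s)) = L2_action \<phi> \<psi> s"
proof -
  \<comment> \<open>Multilinear, with the Casimir tensor to be inserted in the slots \<open>u, u'\<close> and again in \<open>w, w'\<close>.\<close>
  define H where "H u u' w w' = B \<phi> (w \<cdot> u \<cdot> \<psi>) *s (u' \<cdot> w' \<cdot> s)" for u u' w w'
  define x' where "x' j = scaleV (g (x j) (x j)) (x j)" for j
  define f where "f j k = H (x j) (x' j) (x k) (x' k)" for j k
  \<comment> \<open>The \<open>2n\<close> null vectors are indexed by two copies of the modes; \<open>z'\<close> is the family dual to \<open>z\<close>.\<close>
  define D where "D = {1..n} <+> {1..n}"
  define z where "z = case_sum e i"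
  define z' where "z' = case_sum (\<lambda>a. scaleV 2 (i a)) (\<lambda>a. scaleV 2 (e a))"
  have H_linear: "Vector_Spaces.linear scaleV scaleS (\<lambda>u. H u u' w w')"
      "Vector_Spaces.linear scaleV scaleS (\<lambda>u'. H u u' w w')"
      "Vector_Spaces.linear scaleV scaleS (\<lambda>w. H u u' w w')"
      "Vector_Spaces.linear scaleV scaleS (\<lambda>w'. H u u' w w')" for u u' w w'
    by (simp_all add: H_def Vector_Spaces.linear_iff V.vector_space_axioms S.vector_space_axioms
        S.scale_left_distrib S.scale_right_distrib mult.commute)
  let ?H = "\<lambda>c d. H (z c) (z' c) (z d) (z' d)"
  have null: "v = (\<Sum>k\<in>D. scaleV (g v (z k)) (z' k))" for v
    by (subst null_expansion[of v])
      (simp add: D_def z_def z'_def sum.Plus add.commute mult.commute)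
  have casimir: "(\<Sum>j\<in>{1..2*n}. F (x j) (x' j)) = (\<Sum>c\<in>D. F (z c) (z' c))"
    if "\<And>u. Vector_Spaces.linear scaleV scaleS (F u)"
      "\<And>w. Vector_Spaces.linear scaleV scaleS (\<lambda>u. F u w)" for F
    by (rule casimir_independent[OF that g_sym _ null]) (simp only: x'_def flip: expand)
  have all: "(\<Sum>j\<in>{1..2*n}. \<Sum>k\<in>{1..2*n}. f j k) = (\<Sum>c\<in>D. \<Sum>d\<in>D. H (z c) (z' c) (z d) (z' d))"
  proof -
    have "(\<Sum>j\<in>{1..2*n}. \<Sum>k\<in>{1..2*n}. f j k) =
        (\<Sum>j\<in>{1..2*n}. \<Sum>d\<in>D. H (x j) (x' j) (z d) (z' d))"
      unfolding f_def by (intro sum.cong casimir H_linear refl)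
    also have "\<dots> = (\<Sum>d\<in>D. \<Sum>j\<in>{1..2*n}. H (x j) (x' j) (z d) (z' d))"
      by (rule sum.swap)
    also have "\<dots> = (\<Sum>d\<in>D. \<Sum>c\<in>D. H (z c) (z' c) (z d) (z' d))"
      by (intro sum.cong refl, rule casimir) (rule H_linear)+
    also have "\<dots> = (\<Sum>c\<in>D. \<Sum>d\<in>D. H (z c) (z' c) (z d) (z' d))"
      by (rule sum.swap)
    finally show ?thesis .
  qed
  also have "\<dots> = (\<Sum>a\<in>{1..n}. \<Sum>b\<in>{1..n}. ?H (Inr a) (Inr b) + ?H (Inl a) (Inl b)
      + ?H (Inl a) (Inr b) + ?H (Inr a) (Inl b))"
    by (simp only: D_def sum.Plus finite_atLeastAtMost o_def sum.distrib ac_simps)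
  also have "\<dots> = (\<Sum>a\<in>{1..n}. \<Sum>b\<in>{1..n}. 4 *s (
       B (i a \<cdot> i b \<cdot> \<phi>) \<psi> *s e a \<cdot> e b \<cdot> s + B (e a \<cdot> e b \<cdot> \<phi>) \<psi> *s i a \<cdot> i b \<cdot> s
     + B (e a \<cdot> i b \<cdot> \<phi>) \<psi> *s i a \<cdot> e b \<cdot> s + B (i a \<cdot> e b \<cdot> \<phi>) \<psi> *s e a \<cdot> i b \<cdot> s))"
    by (intro sum.cong refl)
      (simp add: z_def z'_def H_def B_adjoint S.scale_right_distrib mult.commute)
  also have "\<dots> = 4 *s (\<Sum>a\<in>{1..n}. \<Sum>b\<in>{1..n}.
       B (i a \<cdot> i b \<cdot> \<phi>) \<psi> *s e a \<cdot> e b \<cdot> s + B (e a \<cdot> e b \<cdot> \<phi>) \<psi> *s i a \<cdot> i b \<cdot> s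
     + B (e a \<cdot> i b \<cdot> \<phi>) \<psi> *s i a \<cdot> e b \<cdot> s + B (i a \<cdot> e b \<cdot> \<phi>) \<psi> *s e a \<cdot> i b \<cdot> s)"
    by (simp only: S.scale_sum_right)
  also have "\<dots> = 4 *s L2_action \<phi> \<psi> s + (2 * of_nat n * B \<phi> \<psi>) *s s"
    by (simp add: L2_action_def S.scale_right_diff_distrib)
  finally have full: "(\<Sum>j\<in>{1..2*n}. \<Sum>k\<in>{1..2*n}. f j k) = 4 *s L2_action \<phi> \<psi> s + (2 * of_nat n * B \<phi> \<psi>) *s s" .
  \<comment> \<open>Orthogonality is known only for indices in range, so \<open>f\<close> is cut off to be symmetric everywhere.\<close>
  define h where "h j k = (if j \<in> {1..2*n} \<and> k \<in> {1..2*n} then f j k else 0)" for j k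
  let ?P = "{(j, k). 1 \<le> j \<and> j < k \<and> k \<le> 2*n}"
  have h_sym: "h j k = h k j" if "j \<noteq> k" for j k
  proof (cases "j \<in> {1..2*n} \<and> k \<in> {1..2*n}")
    case True
    then have swap: "x k \<cdot> x j \<cdot> t = - (x j \<cdot> x k \<cdot> t)" for t
      using act_swap[of "x k" "x j" t] ortho[of k j] that by simp
    have "f j k = f k j"
      unfolding f_def H_def x'_def by (simp add: swap[of \<psi>] swap[of s] mult.commute)
    then show ?thesis by (simp add: h_def)
  qed (auto simp: h_def)
  have diag: "h j j = B \<phi> \<psi> *s s" if "j \<in> {1..2*n}" for j
  proof -
    have "x j \<cdot> x j \<cdot> t = g (x j) (x j) *s t" for t
    proof -
      have "2 *s (x j \<cdot> x j \<cdot> t) = 2 *s (g (x j) (x j) *s t)"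
        using clifford[of "x j" "x j" t] S.scale_left_distrib[of 1 1 "x j \<cdot> x j \<cdot> t"] by simp
      then show ?thesis using two by (simp add: S.scale_left_imp_eq del: S.scale_scale)
    qed
    moreover have "(G * b * (G * (G * G))) = b" if "G * G = 1" for G b :: 'k
      using that by (simp add: ac_simps) 
    ultimately show ?thesis
      using that eps[OF that] by (simp add: h_def f_def H_def x'_def)
  qed
  have "(\<Sum>j\<in>{1..2*n}. \<Sum>k\<in>{1..2*n}. f j k) = (\<Sum>j\<in>{1..2*n}. \<Sum>k\<in>{1..2*n}. h j k)"
    by (simp add: h_def)
  also have "\<dots> = (\<Sum>(j, k)\<in>?P. h j k) + (\<Sum>(j, k)\<in>?P. h j k) + (\<Sum>j\<in>{1..2*n}. h j j)"
    by (rule sum_square_symmetric) (rule h_sym)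
  also have "(\<Sum>j\<in>{1..2*n}. h j j) = (2 * of_nat n * B \<phi> \<psi>) *s s"
    by (simp add: diag flip: S.scale_sum_left)
  finally have "(\<Sum>(j, k)\<in>?P. h j k) + (\<Sum>(j, k)\<in>?P. h j k) = 4 *s L2_action \<phi> \<psi> s"
    using full by simp
  then have "2 *s (\<Sum>(j, k)\<in>?P. h j k) = 2 *s (2 *s L2_action \<phi> \<psi> s)"
    using S.scale_left_distrib[of 1 1 "\<Sum>(j, k)\<in>?P. h j k"] by simp
  then have "(\<Sum>(j, k)\<in>?P. h j k) = 2 *s L2_action \<phi> \<psi> s"
    using two by (simp add: S.scale_left_imp_eq del: S.scale_scale)
  then have "(1 / 2) *s (\<Sum>(j, k)\<in>?P. h j k) = L2_action \<phi> \<psi> s"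
    using two by simp
  moreover have "(\<Sum>(j, k)\<in>?P. h j k) = (\<Sum>(j, k)\<in>?P.
      (g (x j) (x j) * g (x k) (x k) * B \<phi> (x k \<cdot> x j \<cdot> \<psi>)) *s (x j \<cdot> x k \<cdot> s))"
    by (rule sum.cong) (auto simp: h_def f_def H_def x'_def mult.commute mult.left_commute)
  ultimately show ?thesis by simp
qed

section \<open>Which terms survive\<close>

lemma scale_double: "c *s s + c *s s = (2 * c) *s s"
  by (simp flip: S.scale_left_distrib)

context
  fixes I J \<phi> \<psi>
  assumes \<phi>: "occupied I \<phi>" and \<psi>: "occupied J \<psi>"
begin

text \<open>A nonzero coefficient \<open>B (i a \<cdot> i b \<cdot> \<phi>) \<psi>\<close> needs both modes filled in \<open>\<phi>\<close>, and then \<open>J\<close> must be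
  the complement of \<open>I - {a, b}\<close>. The companion rules below arise in the same way, with filled
  and emptied modes.\<close>

lemma selection_ii:
  assumes "a \<in> {1..n}" "b \<in> {1..n}" "B (i a \<cdot> i b \<cdot> \<phi>) \<psi> \<noteq> 0"
  shows "a \<noteq> b" "I \<inter> J = {a, b}" "({1..n} - I) \<inter> ({1..n} - J) = {}"
proof -
  show "a \<noteq> b" using act_twice(2)[of a \<phi>] assms by auto
  have J: "J = {1..n} - (I - {b} - {a})"
    by (rule pairing_occupied[OF _ \<psi> assms(3)]) (intro occupied_i \<phi> assms)+
  have "i b \<cdot> \<phi> \<noteq> 0" using assms(3) by auto
  moreover have "i a \<cdot> \<phi> \<noteq> 0" using assms anticommute(2)[of a b \<phi>] by auto
  ultimately have "a \<in> I" "b \<in> I" using assms \<phi> by (auto simp: occupied_def)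
  then show "I \<inter> J = {a, b}" "({1..n} - I) \<inter> ({1..n} - J) = {}"
    using J assms(1,2) by auto
qed

lemma selection_ee:
  assumes "a \<in> {1..n}" "b \<in> {1..n}" "B (e a \<cdot> e b \<cdot> \<phi>) \<psi> \<noteq> 0"
  shows "a \<noteq> b" "I \<inter> J = {}" "({1..n} - I) \<inter> ({1..n} - J) = {a, b}"
proof -
  show "a \<noteq> b" using act_twice(1)[of a \<phi>] assms by auto
  have J: "J = {1..n} - insert a (insert b I)"
    by (rule pairing_occupied[OF _ \<psi> assms(3)]) (intro occupied_e \<phi> assms)+
  have "e b \<cdot> \<phi> \<noteq> 0" using assms(3) by auto
  moreover have "e a \<cdot> \<phi> \<noteq> 0" using assms anticommute(1)[of a b \<phi>] by auto
  ultimately have "a \<notin> I" "b \<notin> I" using assms \<phi> by (auto simp: occupied_def)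
  then show "I \<inter> J = {}" "({1..n} - I) \<inter> ({1..n} - J) = {a, b}"
    using J assms(1,2) by auto
qed

lemma selection_ei:
  assumes "a \<in> {1..n}" "b \<in> {1..n}" "a \<noteq> b" "B (e a \<cdot> i b \<cdot> \<phi>) \<psi> \<noteq> 0"
  shows "I \<inter> J = {b}" "({1..n} - I) \<inter> ({1..n} - J) = {a}"
proof -
  have J: "J = {1..n} - insert a (I - {b})"
    by (rule pairing_occupied[OF _ \<psi> assms(4)]) (intro occupied_e occupied_i \<phi> assms)+
  have "i b \<cdot> \<phi> \<noteq> 0" using assms by auto
  moreover have "e a \<cdot> \<phi> \<noteq> 0" using assms anticommute(4)[of a b \<phi>] by auto
  ultimately have "a \<notin> I" "b \<in> I" using assms \<phi> by (auto simp: occupied_def)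
  then show "I \<inter> J = {b}" "({1..n} - I) \<inter> ({1..n} - J) = {a}"
    using J assms(1-3) by auto
qed

lemma selection_ie:
  assumes "a \<in> {1..n}" "b \<in> {1..n}" "a \<noteq> b" "B (i b \<cdot> e a \<cdot> \<phi>) \<psi> \<noteq> 0"
  shows "I \<inter> J = {b}" "({1..n} - I) \<inter> ({1..n} - J) = {a}"
  using assms selection_ei[OF assms(1-3)] anticommute(4)[of a b \<phi>] by auto

lemma selection_diagonal:
  assumes "a \<in> {1..n}" "B \<phi> \<psi> \<noteq> 0 \<or> B (e a \<cdot> i a \<cdot> \<phi>) \<psi> \<noteq> 0 \<or> B (i a \<cdot> e a \<cdot> \<phi>) \<psi> \<noteq> 0"
  shows "I \<inter> J = {}" "({1..n} - I) \<inter> ({1..n} - J) = {}"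
proof -
  have "B \<phi> \<psi> \<noteq> 0" using assms number_operator[OF \<phi> assms(1)] by (auto split: if_splits)
  then show "I \<inter> J = {}" "({1..n} - I) \<inter> ({1..n} - J) = {}"
    using pairing_occupied[OF \<phi> \<psi>] \<phi> by (auto simp: occupied_def)
qed

text \<open>Both orders of the pair contribute, and equally, since each factor changes sign when \<open>a\<close> and
  \<open>b\<close> are exchanged; this is the source of the factor \<open>2\<close>.\<close>

lemma L2_action_pair_removed:
  assumes ab: "a \<in> {1..n}" "b \<in> {1..n}" "a \<noteq> b"
    and "I \<inter> J = {a, b}" "({1..n} - I) \<inter> ({1..n} - J) = {}"
  shows "L2_action \<phi> \<psi> s = (2 * B (i a \<cdot> i b \<cdot> \<phi>) \<psi>) *s e a \<cdot> e b \<cdot> s"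
proof -
  have [simp]: "B \<phi> \<psi> = 0" using selection_diagonal[OF ab(1)] assms by auto
  have zero: "B (e c \<cdot> e d \<cdot> \<phi>) \<psi> = 0" "B (e c \<cdot> i d \<cdot> \<phi>) \<psi> = 0" "B (i c \<cdot> e d \<cdot> \<phi>) \<psi> = 0"
    if "c \<in> {1..n}" "d \<in> {1..n}" for c d
    using selection_ee[OF that] selection_ei[OF that] selection_ie[OF that(2,1)] selection_diagonal[OF that(1)]
      assms by auto
  have "L2_action \<phi> \<psi> s = (\<Sum>c\<in>{1..n}. \<Sum>d\<in>{1..n}. B (i c \<cdot> i d \<cdot> \<phi>) \<psi> *s e c \<cdot> e d \<cdot> s)"
    unfolding L2_action_def by (simp add: zero)
  also have "\<dots> = B (i a \<cdot> i b \<cdot> \<phi>) \<psi> *s e a \<cdot> e b \<cdot> s + B (i b \<cdot> i a \<cdot> \<phi>) \<psi> *s e b \<cdot> e a \<cdot> s"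
  proof (rule sum_two_terms[OF _ ab])
    fix c d assume "c \<in> {1..n}" "d \<in> {1..n}"
    then show "c \<noteq> d \<and> {c, d} = {a, b} \<or> B (i c \<cdot> i d \<cdot> \<phi>) \<psi> *s e c \<cdot> e d \<cdot> s = 0"
      using selection_ii[of c d] assms by auto
  qed simp
  also have "\<dots> = (2 * B (i a \<cdot> i b \<cdot> \<phi>) \<psi>) *s e a \<cdot> e b \<cdot> s"
    using anticommute(1,2)[OF ab(2,1)] by (simp add: scale_double)
  finally show ?thesis .
qed

lemma L2_action_pair_added:
  assumes ab: "a \<in> {1..n}" "b \<in> {1..n}" "a \<noteq> b"
    and "I \<inter> J = {}" "({1..n} - I) \<inter> ({1..n} - J) = {a, b}"
  shows "L2_action \<phi> \<psi> s = (2 * B (e a \<cdot> e b \<cdot> \<phi>) \<psi>) *s i a \<cdot> i b \<cdot> s"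
proof -
  have [simp]: "B \<phi> \<psi> = 0" using selection_diagonal[OF ab(1)] assms by auto
  have zero: "B (i c \<cdot> i d \<cdot> \<phi>) \<psi> = 0" "B (e c \<cdot> i d \<cdot> \<phi>) \<psi> = 0" "B (i c \<cdot> e d \<cdot> \<phi>) \<psi> = 0"
    if "c \<in> {1..n}" "d \<in> {1..n}" for c d
    using selection_ii[OF that] selection_ei[OF that] selection_ie[OF that(2,1)] selection_diagonal[OF that(1)]
      assms by auto
  have "L2_action \<phi> \<psi> s = (\<Sum>c\<in>{1..n}. \<Sum>d\<in>{1..n}. B (e c \<cdot> e d \<cdot> \<phi>) \<psi> *s i c \<cdot> i d \<cdot> s)"
    unfolding L2_action_def by (simp add: zero)
  also have "\<dots> = B (e a \<cdot> e b \<cdot> \<phi>) \<psi> *s i a \<cdot> i b \<cdot> s + B (e b \<cdot> e a \<cdot> \<phi>) \<psi> *s i b \<cdot> i a \<cdot> s"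
  proof (rule sum_two_terms[OF _ ab])
    fix c d assume "c \<in> {1..n}" "d \<in> {1..n}"
    then show "c \<noteq> d \<and> {c, d} = {a, b} \<or> B (e c \<cdot> e d \<cdot> \<phi>) \<psi> *s i c \<cdot> i d \<cdot> s = 0"
      using selection_ee[of c d] assms by auto
  qed simp
  also have "\<dots> = (2 * B (e a \<cdot> e b \<cdot> \<phi>) \<psi>) *s i a \<cdot> i b \<cdot> s"
    using anticommute(1,2)[OF ab(2,1)] by (simp add: scale_double)
  finally show ?thesis .
qed

text \<open>Here the two equal contributions come from different families of terms: \<open>e i\<close> at \<open>(a, b)\<close> and
  \<open>i e\<close> at \<open>(b, a)\<close>.\<close>

lemma L2_action_exchange:
  assumes ab: "a \<in> {1..n}" "b \<in> {1..n}" "a \<noteq> b"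
    and IJ: "I \<inter> J = {b}" "({1..n} - I) \<inter> ({1..n} - J) = {a}"
  shows "L2_action \<phi> \<psi> s = (2 * B (e a \<cdot> i b \<cdot> \<phi>) \<psi>) *s i a \<cdot> e b \<cdot> s"
proof -
  have [simp]: "B \<phi> \<psi> = 0" using selection_diagonal[OF ab(1)] IJ by auto
  have zero: "B (e c \<cdot> e d \<cdot> \<phi>) \<psi> = 0" "B (i c \<cdot> i d \<cdot> \<phi>) \<psi> = 0"
    if "c \<in> {1..n}" "d \<in> {1..n}" for c d
    using selection_ee[OF that] selection_ii[OF that] IJ by auto
  have zero': "B (e c \<cdot> i d \<cdot> \<phi>) \<psi> = 0" "B (i d \<cdot> e c \<cdot> \<phi>) \<psi> = 0"
    if cd: "c \<in> {1..n}" "d \<in> {1..n}" "(c, d) \<noteq> (a, b)" for c d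
  proof -
    have "\<not> (I \<inter> J = {d} \<and> ({1..n} - I) \<inter> ({1..n} - J) = {c})"
      using cd(3) unfolding IJ by blast
    then show "B (e c \<cdot> i d \<cdot> \<phi>) \<psi> = 0" "B (i d \<cdot> e c \<cdot> \<phi>) \<psi> = 0"
      using selection_ei[OF cd(1,2)] selection_ie[OF cd(1,2)] selection_diagonal[OF cd(1)] IJ(1)
      by blast+
  qed
  let ?f = "\<lambda>c d. B (e c \<cdot> i d \<cdot> \<phi>) \<psi> *s i c \<cdot> e d \<cdot> s + B (i c \<cdot> e d \<cdot> \<phi>) \<psi> *s e c \<cdot> i d \<cdot> s"
  have "L2_action \<phi> \<psi> s = (\<Sum>c\<in>{1..n}. \<Sum>d\<in>{1..n}. ?f c d)"
    unfolding L2_action_def by (simp add: zero)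
  also have "\<dots> = ?f a b + ?f b a"
  proof (rule sum_two_terms[OF _ ab])
    fix c d assume "c \<in> {1..n}" "d \<in> {1..n}"
    then show "c \<noteq> d \<and> {c, d} = {a, b} \<or> ?f c d = 0"
      using zero'[of c d] zero'[of d c] ab(3) by (cases "(c, d) = (a, b) \<or> (d, c) = (a, b)") auto
  qed simp
  also have "\<dots> = (2 * B (e a \<cdot> i b \<cdot> \<phi>) \<psi>) *s i a \<cdot> e b \<cdot> s"
    using zero'(1)[OF ab(2,1)] zero'(2)[OF ab(2,1)] ab(3)
      anticommute(4)[OF ab, of \<phi>] anticommute(3)[OF ab, of s] scale_double by simp
  finally show ?thesis .
qed

text \<open>Only diagonal terms survive. The mode \<open>a\<close> contributes \<open>B \<phi> \<psi>\<close> precisely when it lies in exactly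
  one of \<open>I\<close> and \<open>K\<close>, which is the weight \<open>?w a\<close> below; subtracting \<open>n/2\<close> gives the coefficient.\<close>

lemma L2_action_scalar:
  assumes IJ: "I \<inter> J = {}" "({1..n} - I) \<inter> ({1..n} - J) = {}" and s: "occupied K s"
  shows "L2_action \<phi> \<psi> s = (1 / 2 * B \<phi> \<psi> * (of_nat n - 2 * of_nat (card (I \<inter> K))
    - 2 * of_nat (card (({1..n} - I) \<inter> ({1..n} - K))))) *s s"
proof -
  let ?T = "\<lambda>a b. B (i a \<cdot> i b \<cdot> \<phi>) \<psi> *s e a \<cdot> e b \<cdot> s + B (e a \<cdot> e b \<cdot> \<phi>) \<psi> *s i a \<cdot> i b \<cdot> s
     + B (e a \<cdot> i b \<cdot> \<phi>) \<psi> *s i a \<cdot> e b \<cdot> s + B (i a \<cdot> e b \<cdot> \<phi>) \<psi> *s e a \<cdot> i b \<cdot> s"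
  let ?w = "\<lambda>a. 1 - of_bool (a \<in> I \<inter> K) - of_bool (a \<in> ({1..n} - I) \<inter> ({1..n} - K)) :: 'k"
  have T: "?T a b = (if a = b then (B \<phi> \<psi> * ?w a) *s s else 0)" if ab: "a \<in> {1..n}" "b \<in> {1..n}" for a b
  proof -
    have "B (i a \<cdot> i b \<cdot> \<phi>) \<psi> = 0" "B (e a \<cdot> e b \<cdot> \<phi>) \<psi> = 0"
      using selection_ii[OF ab] selection_ee[OF ab] IJ by auto
    moreover have "B (e a \<cdot> i b \<cdot> \<phi>) \<psi> = 0" "B (i a \<cdot> e b \<cdot> \<phi>) \<psi> = 0" if "a \<noteq> b"
      using selection_ei[OF ab that] selection_ie[OF ab(2,1) that[symmetric]] IJ by auto
    ultimately show ?thesis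
      using number_operator[OF \<phi> ab(1)] number_operator[OF s ab(1)] ab by (auto simp del: mult_cancel_left)
  qed
  have "(\<Sum>a\<in>{1..n}. \<Sum>b\<in>{1..n}. ?T a b) = (\<Sum>a\<in>{1..n}. (B \<phi> \<psi> * ?w a) *s s)"
    by (rule sum.cong[OF refl], subst sum.cong[OF refl T]) simp_all
  also have "\<dots> = (B \<phi> \<psi> * (\<Sum>a\<in>{1..n}. ?w a)) *s s"
    by (simp only: S.scale_sum_left sum_distrib_left)
  also have "(\<Sum>a\<in>{1..n}. ?w a) =
      of_nat n - of_nat (card (I \<inter> K)) - of_nat (card (({1..n} - I) \<inter> ({1..n} - K)))"
  proof -
    have "{1..n} \<inter> {a. a \<in> I \<inter> K} = I \<inter> K"
        "{1..n} \<inter> {a. a \<in> ({1..n} - I) \<inter> ({1..n} - K)} = ({1..n} - I) \<inter> ({1..n} - K)"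
      using \<phi> by (auto simp: occupied_def)
    then show ?thesis by (simp only: sum_subtractf sum_of_bool_eq finite_atLeastAtMost) simp
  qed
  finally have "L2_action \<phi> \<psi> s = (B \<phi> \<psi> * (of_nat n - of_nat (card (I \<inter> K))
      - of_nat (card (({1..n} - I) \<inter> ({1..n} - K)))) - of_nat n / 2 * B \<phi> \<psi>) *s s"
    unfolding L2_action_def S.scale_left_diff_distrib by (rule arg_cong)
  then show ?thesis using two by (simp add: field_simps)
qed

lemma L2_action_zero:
  assumes "\<not> (I \<inter> J = {} \<and> ({1..n} - I) \<inter> ({1..n} - J) = {})"
    and "\<And>a b. a \<in> {1..n} \<Longrightarrow> b \<in> {1..n} \<Longrightarrow> a \<noteq> b \<Longrightarrow>
      \<not> (I \<inter> J = {} \<and> ({1..n} - I) \<inter> ({1..n} - J) = {a, b}) \<and>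
      \<not> (I \<inter> J = {a, b} \<and> ({1..n} - I) \<inter> ({1..n} - J) = {}) \<and>
      \<not> (I \<inter> J = {b} \<and> ({1..n} - I) \<inter> ({1..n} - J) = {a})"
    and "n \<ge> 1"
  shows "L2_action \<phi> \<psi> s = 0"
proof -
  have "B \<phi> \<psi> = 0" using selection_diagonal[of 1] assms(1,3) by auto
  moreover have "B (i a \<cdot> i b \<cdot> \<phi>) \<psi> = 0" if ab: "a \<in> {1..n}" "b \<in> {1..n}" for a b
    using selection_ii[OF ab] assms(2)[OF ab] by blast
  moreover have "B (e a \<cdot> e b \<cdot> \<phi>) \<psi> = 0" if ab: "a \<in> {1..n}" "b \<in> {1..n}" for a b
    using selection_ee[OF ab] assms(2)[OF ab] by blast
  moreover have "B (e a \<cdot> i b \<cdot> \<phi>) \<psi> = 0" if ab: "a \<in> {1..n}" "b \<in> {1..n}" for a b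
    using selection_ei[OF ab] selection_diagonal[OF ab(1)] assms(1) assms(2)[OF ab] by blast
  moreover have "B (i b \<cdot> e a \<cdot> \<phi>) \<psi> = 0" if ab: "a \<in> {1..n}" "b \<in> {1..n}" for a b
    using selection_ie[OF ab] selection_diagonal[OF ab(1)] assms(1) assms(2)[OF ab] by blast
  ultimately show ?thesis by (simp add: L2_action_def)
qed

end

section \<open>Nonvanishing\<close>

lemma e_nonzero:
  assumes "occupied A s" "a \<in> {1..n}" "a \<notin> A" "s \<noteq> 0"
  shows "e a \<cdot> s \<noteq> 0"
  using number_operator(2)[OF assms(1,2)] assms(3,4) by auto

lemma i_nonzero:
  assumes "occupied A s" "a \<in> A" "s \<noteq> 0"
  shows "i a \<cdot> s \<noteq> 0"
  using number_operator(1)[OF assms(1), of a] assms by (auto simp: occupied_def)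

lemma occupied_vac: "occupied {} vac"
  by (simp add: occupied_def i_vac)

text \<open>In the scalar case the coefficient may vanish in \<open>k\<close> for a particular \<open>K\<close>, so two choices are
  compared: \<open>K = I\<close> gives \<open>-n\<close>, and toggling a single mode gives \<open>2 - n\<close>. They cannot both be
  zero when \<open>2 \<noteq> 0\<close>. In the other cases one explicit \<open>s\<close> on which the operators act without
  annihilating suffices.\<close>

lemma L2_action_nonzero:
  assumes I: "distinct I" "set I \<subseteq> {1..n}" and J: "distinct J" "set J \<subseteq> {1..n}" and n: "n \<ge> 1"
    and cases: "set I \<inter> set J = {} \<and> ({1..n} - set I) \<inter> ({1..n} - set J) = {} \<or>
      (\<exists>a\<in>{1..n}. \<exists>b\<in>{1..n}. a \<noteq> b \<and>
        (set I \<inter> set J = {} \<and> ({1..n} - set I) \<inter> ({1..n} - set J) = {a, b} \<or>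
         set I \<inter> set J = {a, b} \<and> ({1..n} - set I) \<inter> ({1..n} - set J) = {} \<or>
         set I \<inter> set J = {b} \<and> ({1..n} - set I) \<inter> ({1..n} - set J) = {a}))"
  shows "\<exists>s. L2_action (state I) (state J) s \<noteq> 0"
proof -
  note oI = occupied_state[OF I(2)] and oJ = occupied_state[OF J(2)]
    and nz = state_nonzero[OF I]
  show ?thesis
    using cases
  proof (elim disjE bexE conjE)
    assume d: "set I \<inter> set J = {}" "({1..n} - set I) \<inter> ({1..n} - set J) = {}"
    have B: "B (state I) (state J) \<noteq> 0"
      by (rule pairing_state_nonzero[OF oI nz J(1)]) (use d J(2) in auto)
    show ?thesis
    proof (rule ccontr)
      assume "\<not> ?thesis"
      then have weight: "(of_nat n :: 'k) = 2 * of_nat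
          (card (set I \<inter> K) + card (({1..n} - set I) \<inter> ({1..n} - K)))"
        if "occupied K s" "s \<noteq> 0" for K s
      proof -
        have "1 / 2 * B (state I) (state J) * (of_nat n - 2 * of_nat (card (set I \<inter> K))
            - 2 * of_nat (card (({1..n} - set I) \<inter> ({1..n} - K)))) = 0"
          using L2_action_scalar[OF oI oJ d that(1)] \<open>\<not> (\<exists>s. _)\<close> that(2)
          by (metis S.scale_eq_0_iff)
        then have "of_nat n - 2 * of_nat (card (set I \<inter> K))
            - 2 * of_nat (card (({1..n} - set I) \<inter> ({1..n} - K))) = (0 :: 'k)"
          using two B by (metis divide_eq_0_iff mult_eq_0_iff zero_neq_one)
        then show ?thesis by (simp add: algebra_simps)
      qed
      have "card (set I) + card ({1..n} - set I) = n"
        using card_Un_disjoint[of "set I" "{1..n} - set I"] I(2) by (simp add: Un_absorb1)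
      then have all: "(of_nat n :: 'k) = 2 * of_nat n"
        using weight[OF oI nz] by simp
      \<comment> \<open>Toggle mode 1, which exists because \<open>n \<ge> 1\<close>.\<close>
      have "\<exists>K s. occupied K s \<and> s \<noteq> 0 \<and>
        Suc (card (set I \<inter> K) + card (({1..n} - set I) \<inter> ({1..n} - K))) = n"
      proof (cases "1 \<in> set I")
        case True
        then have "set I \<inter> (set I - {1}) = set I - {1}"
          "({1..n} - set I) \<inter> ({1..n} - (set I - {1})) = {1..n} - set I" by auto
        moreover have "Suc (card (set I - {1})) = card (set I)"
          using True by (intro card_Suc_Diff1) auto
        ultimately show ?thesis
          using \<open>card (set I) + card ({1..n} - set I) = n\<close> occupied_i[OF oI, of 1] n
            i_nonzero[OF oI True nz]
          by (intro exI[of _ "set I - {1}"] exI[of _ "i 1 \<cdot> state I"]) simp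
      next
        case False
        then have "set I \<inter> insert 1 (set I) = set I"
          "({1..n} - set I) \<inter> ({1..n} - insert 1 (set I)) = ({1..n} - set I) - {1}" by auto
        moreover have "Suc (card (({1..n} - set I) - {1})) = card ({1..n} - set I)"
          using False n by (intro card_Suc_Diff1) auto
        ultimately show ?thesis
          using \<open>card (set I) + card ({1..n} - set I) = n\<close> occupied_e[OF oI, of 1] n
            e_nonzero[OF oI _ False nz]
          by (intro exI[of _ "insert 1 (set I)"] exI[of _ "e 1 \<cdot> state I"]) simp
      qed
      then obtain K s where K: "occupied K s" "s \<noteq> 0"
        "Suc (card (set I \<inter> K) + card (({1..n} - set I) \<inter> ({1..n} - K))) = n" by blast
      define m where "m = card (set I \<inter> K) + card (({1..n} - set I) \<inter> ({1..n} - K))"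
      have "(of_nat n :: 'k) = 2 * of_nat m" "of_nat n = 1 + (of_nat m :: 'k)"
        using weight[OF K(1,2)] arg_cong[OF K(3), of "of_nat :: nat \<Rightarrow> 'k"] by (simp_all add: m_def)
      moreover have "of_nat n = (0 :: 'k)" using all by (metis add_cancel_right_right mult_2)
      ultimately show False using two by simp
    qed
  next
    fix a b assume ab: "a \<in> {1..n}" "b \<in> {1..n}" "a \<noteq> b"
      and c: "set I \<inter> set J = {}" "({1..n} - set I) \<inter> ({1..n} - set J) = {a, b}"
    then have out: "b \<notin> set I" "a \<notin> insert b (set I)" by auto
    have "B (e a \<cdot> e b \<cdot> state I) (state J) \<noteq> 0"
    proof (rule pairing_state_nonzero[OF occupied_e[OF occupied_e[OF oI ab(2)] ab(1)] _ J(1)])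
      show "e a \<cdot> e b \<cdot> state I \<noteq> 0"
        by (intro e_nonzero[OF occupied_e[OF oI]] e_nonzero[OF oI] ab out nz)
      show "set J = {1..n} - insert a (insert b (set I))" using c J(2) by blast
    qed
    moreover have "i a \<cdot> i b \<cdot> e b \<cdot> e a \<cdot> vac = vac"
      using number_operator(2)[OF occupied_e[OF occupied_vac ab(1)] ab(2)] number_operator(2)[OF occupied_vac ab(1)] ab(3)
      by simp
    ultimately show ?thesis
      using L2_action_pair_added[OF oI oJ ab c] two vac_nonzero
      by (intro exI[of _ "e b \<cdot> e a \<cdot> vac"]) simp
  next
    fix a b assume ab: "a \<in> {1..n}" "b \<in> {1..n}" "a \<noteq> b"
      and c: "set I \<inter> set J = {a, b}" "({1..n} - set I) \<inter> ({1..n} - set J) = {}"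
    then have ins: "b \<in> set I" "a \<in> set I - {b}" by auto
    have "B (i a \<cdot> i b \<cdot> state I) (state J) \<noteq> 0"
    proof (rule pairing_state_nonzero[OF occupied_i[OF occupied_i[OF oI ab(2)] ab(1)] _ J(1)])
      show "i a \<cdot> i b \<cdot> state I \<noteq> 0"
        by (intro i_nonzero[OF occupied_i[OF oI]] i_nonzero[OF oI] ab ins nz)
      show "set J = {1..n} - (set I - {b} - {a})" using c J(2) ins by blast
    qed
    moreover have "state [a, b] \<noteq> 0" by (rule state_nonzero) (use ab in auto)
    ultimately show ?thesis
      using L2_action_pair_removed[OF oI oJ ab c] two by (intro exI[of _ vac]) simp
  next
    fix a b assume ab: "a \<in> {1..n}" "b \<in> {1..n}" "a \<noteq> b"
      and c: "set I \<inter> set J = {b}" "({1..n} - set I) \<inter> ({1..n} - set J) = {a}"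
    then have io: "b \<in> set I" "a \<notin> set I - {b}" by auto
    have "B (e a \<cdot> i b \<cdot> state I) (state J) \<noteq> 0"
    proof (rule pairing_state_nonzero[OF occupied_e[OF occupied_i[OF oI ab(2)] ab(1)] _ J(1)])
      show "e a \<cdot> i b \<cdot> state I \<noteq> 0"
        by (intro e_nonzero[OF occupied_i[OF oI]] i_nonzero[OF oI] ab io nz)
      show "set J = {1..n} - insert a (set I - {b})" using c J(2) io ab by blast
    qed
    moreover have "state [b, a] \<noteq> 0" by (rule state_nonzero) (use ab in auto)
    then have "i a \<cdot> state [b, a] \<noteq> 0"
      using ab by (intro i_nonzero[OF occupied_state]) auto
    ultimately show ?thesis
      using L2_action_exchange[OF oI oJ ab c] two by (intro exI[of _ "state [a]"]) simp
  qed
qed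

end

section \<open>The values of the map on basis spinors\<close>

theorem proposition6p3:
  fixes scaleV :: "'k::field \<Rightarrow> 'v::ab_group_add \<Rightarrow> 'v"
    and scaleS :: "'k \<Rightarrow> 's::ab_group_add \<Rightarrow> 's"
    and g :: "'v \<Rightarrow> 'v \<Rightarrow> 'k"
    and \<rho> :: "('v, 'k) clifford \<Rightarrow> 's \<Rightarrow> 's"
    and B :: "'s \<Rightarrow> 's \<Rightarrow> 'k"
    and x i e :: "nat \<Rightarrow> 'v"
    and \<I> \<E> :: "'v set"
    and \<v> :: 's
    and n :: nat
    and I J :: "nat list"
  assumes "CHAR('k) \<noteq> 2" and "CHAR('k) \<noteq> 3"
    and "n \<ge> 1"
    and "vector_space scaleV" and "vector_space.dim scaleV UNIV = 2 * n"
    and "bilinear_map scaleV g" and "\<forall>v w. g v w = g w v"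
    and "nondegenerate g" and "witt_index scaleV g = n"
    and "vector_space scaleS" and "vector_space.dim scaleS UNIV = 2 ^ n"
    and "spinor_representation scaleV g scaleS \<rho>"
    and "spinor_norm scaleV g scaleS \<rho> B" and "nondegenerate B"
    and "orthonormal_basis scaleV g (2 * n) x"
    and "polarisation scaleV g n \<I> \<E>"
    and "indexed_basis scaleV n \<I> i" and "indexed_basis scaleV n \<E> e"
    and "\<forall>a\<in>{1..n}. \<forall>b\<in>{1..n}. g (e a) (i b) = (if a = b then 1 / 2 else 0)"
    and "pure_spinor scaleV g \<rho> n i \<v>"
    and "ordered_subset n I" and "ordered_subset n J"
  shows
    "let C = clifford_algebra scaleV g;
         prd = clifford_product scaleV g;
         L2 = spinor_L2 scaleV g \<rho> B (2 * n) x;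
         spinor = (\<lambda>vs. \<rho> (prd vs) \<v>);
         eV = (\<lambda>K. spinor (map e K));
         cmpl = (\<lambda>K. {1..n} - set K);
         case_a = (\<lambda>a b. set I \<inter> set J = {} \<and> cmpl I \<inter> cmpl J = {a, b});
         case_b = (\<lambda>a b. set I \<inter> set J = {a, b} \<and> cmpl I \<inter> cmpl J = {});
         case_c = (\<lambda>a b. set I \<inter> set J = {b} \<and> cmpl I \<inter> cmpl J = {a});
         case_d = (set I \<inter> set J = {} \<and> cmpl I \<inter> cmpl J = {})
     in (L2 (eV I) (eV J) \<noteq> \<zero>\<^bsub>C\<^esub> \<longleftrightarrow>
           (\<exists>a\<in>{1..n}. \<exists>b\<in>{1..n}. a \<noteq> b \<and> (case_a a b \<or> case_b a b \<or> case_c a b)) \<or> case_d) \<and>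
        (\<forall>K. ordered_subset n K \<longrightarrow>
          (\<forall>a\<in>{1..n}. \<forall>b\<in>{1..n}. a \<noteq> b \<longrightarrow>
            (case_a a b \<longrightarrow>
              \<rho> (L2 (eV I) (eV J)) (eV K) =
                scaleS (2 * B (spinor (e a # e b # map e I)) (eV J)) (spinor (i a # i b # map e K))) \<and>
            (case_b a b \<longrightarrow>
              \<rho> (L2 (eV I) (eV J)) (eV K) =
                scaleS (2 * B (spinor (i a # i b # map e I)) (eV J)) (spinor (e a # e b # map e K))) \<and>
            (case_c a b \<longrightarrow>
              \<rho> (L2 (eV I) (eV J)) (eV K) =
                scaleS (2 * B (spinor (e a # i b # map e I)) (eV J)) (spinor (i a # e b # map e K)))) \<and>
          (case_d \<longrightarrow>
            \<rho> (L2 (eV I) (eV J)) (eV K) =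
              scaleS (1 / 2 * B (eV I) (eV J) *
                  (of_nat n - 2 * of_nat (card (set I \<inter> set K))
                            - 2 * of_nat (card (cmpl I \<inter> cmpl K))))
                (eV K)))"
proof -
  let ?act = "\<lambda>v. \<rho> (clifford_vector scaleV g v)"
  let ?C = "clifford_algebra scaleV g"
  note \<rho> = \<open>spinor_representation scaleV g scaleS \<rho>\<close>
  interpret V: vector_space scaleV by fact
  interpret S: vector_space scaleS by fact
  interpret C: ring ?C by (rule ring_clifford_algebra)
  have two: "(2::'k) \<noteq> 0"
  proof
    assume "(2::'k) = 0"
    then have "CHAR('k) dvd 2"
      using of_nat_eq_0_iff_char_dvd[of 2, where 'a = 'k] by simp
    then have "CHAR('k) \<in> {1, 2}" using dvd_imp_le[of "CHAR('k)" 2] by (cases "CHAR('k)") auto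
    then show False using \<open>CHAR('k) \<noteq> 2\<close> CHAR_not_1 by auto
  qed
  note rep = spinor_representation_hom[OF \<rho> clifford_vector_closed clifford_vector_closed]
  have g_linear: "Vector_Spaces.linear scaleV (*) (\<lambda>v. g v w)" for w
    using \<open>bilinear_map scaleV g\<close> by (simp add: bilinear_map_def)
  have g_sym: "g v w = g w v" for v w using \<open>\<forall>v w. g v w = g w v\<close> by simp
  have g_simps: "g (v + w) u = g v u + g w u" "g (scaleV c v) u = c * g v u"
      "g u (scaleV c v) = c * g u v" for u v w c
    using g_linear[of u] g_sym[of u] by (simp_all add: Vector_Spaces.linear_iff)
  have iS: "V.span (i ` {1..n}) = \<I>" and eS: "V.span (e ` {1..n}) = \<E>"
    using \<open>indexed_basis scaleV n \<I> i\<close> \<open>indexed_basis scaleV n \<E> e\<close>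
    by (simp_all only: indexed_basis_def)
  have iI: "i a \<in> \<I>" and eE: "e a \<in> \<E>" if "a \<in> {1..n}" for a
    using that iS eS V.span_base by blast+
  have iso: "g v w = 0" if "v \<in> \<I> \<and> w \<in> \<I> \<or> v \<in> \<E> \<and> w \<in> \<E>" for v w
    using that \<open>polarisation scaleV g n \<I> \<E>\<close> by (auto simp: polarisation_def totally_isotropic_def)
  have ei: "g (e a) (i b) = (if a = b then 1 / 2 else 0)" if "a \<in> {1..n}" "b \<in> {1..n}" for a b
    using that assms by blast
  interpret F: spinor_fock scaleV scaleS g ?act B n i e \<v>
  proof (rule spinor_fock.intro[OF V.vector_space_axioms S.vector_space_axioms],
      rule spinor_fock_axioms.intro)
    show "(2::'k) \<noteq> 0" by (rule two)
    show "Vector_Spaces.linear scaleS scaleS (?act v)" for v by (rule rep(6))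
    show "Vector_Spaces.linear scaleV scaleS (\<lambda>v. ?act v s)" for s
      by (simp add: Vector_Spaces.linear_iff V.vector_space_axioms S.vector_space_axioms
          clifford_vector_linear rep(1,5))
    show "?act v (?act w s) + ?act w (?act v s) = scaleS (2 * g v w) s" for v w s
    proof -
      have "\<rho> (clifford_vector scaleV g v \<otimes>\<^bsub>?C\<^esub> clifford_vector scaleV g w \<oplus>\<^bsub>?C\<^esub>
          clifford_vector scaleV g w \<otimes>\<^bsub>?C\<^esub> clifford_vector scaleV g v) s = scaleS (2 * g v w) s"
        unfolding clifford_relation by (rule rep(4))
      then show ?thesis
        by (simp add: spinor_representation_hom(1)[OF \<rho>] rep(2))
    qed
    show "W = UNIV" if "S.subspace W" "\<And>v s. s \<in> W \<Longrightarrow> ?act v s \<in> W" "s \<in> W" "s \<noteq> 0" for W s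
      by (rule spinor_representation_irreducible[OF \<rho> that])
    show "bilinear_map scaleS B" "B (?act v \<phi>) \<psi> = B \<phi> (?act v \<psi>)" for v \<phi> \<psi>
      using \<open>spinor_norm scaleV g scaleS \<rho> B\<close> by (simp_all add: spinor_norm_def)
    show "nondegenerate B" by fact
    show "g v w = g w v" for v w by (rule g_sym)
    show "g (e a) (e b) = 0" "g (i a) (i b) = 0" if "a \<in> {1..n}" "b \<in> {1..n}" for a b
      using iI eE that by (blast intro: iso)+
    show "g (e a) (i b) = (if a = b then 1 / 2 else 0)" if "a \<in> {1..n}" "b \<in> {1..n}" for a b
      by (rule ei[OF that])
    show "v = (\<Sum>a\<in>{1..n}. scaleV (2 * g v (i a)) (e a)) +
        (\<Sum>a\<in>{1..n}. scaleV (2 * g v (e a)) (i a))" for v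
    proof -
      obtain p q where pq: "p \<in> \<I>" "q \<in> \<E>" "v = p + q"
        using \<open>polarisation scaleV g n \<I> \<E>\<close> unfolding polarisation_def by blast
      have gv: "g v (e a) = g p (e a)" "g v (i a) = g q (i a)" if "a \<in> {1..n}" for a
        using iso[of q "e a"] iso[of p "i a"] pq iI[OF that] eE[OF that] by (simp_all add: g_simps)
      have "p = (\<Sum>a\<in>{1..n}. scaleV (g p (scaleV 2 (e a))) (i a))"
        by (rule dual_family_expansion[OF g_linear])
          (use pq(1) two in \<open>simp_all add: iS[symmetric] g_simps g_sym[of "i _"] ei\<close>)
      also have "\<dots> = (\<Sum>a\<in>{1..n}. scaleV (2 * g v (e a)) (i a))"
        by (rule sum.cong) (simp_all add: g_simps gv)
      finally have p: "p = \<dots>" .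
      have "q = (\<Sum>a\<in>{1..n}. scaleV (g q (scaleV 2 (i a))) (e a))"
        by (rule dual_family_expansion[OF g_linear])
          (use pq(2) two in \<open>simp_all add: eS[symmetric] g_simps ei\<close>)
      also have "\<dots> = (\<Sum>a\<in>{1..n}. scaleV (2 * g v (i a)) (e a))"
        by (rule sum.cong) (simp_all add: g_simps gv)
      finally have q: "q = \<dots>" .
      show ?thesis
        unfolding p[symmetric] q[symmetric] by (simp only: pq(3) add.commute)
    qed
    show "\<v> \<noteq> 0" "\<And>a. a \<in> {1..n} \<Longrightarrow> ?act (i a) \<v> = 0"
      using \<open>pure_spinor scaleV g \<rho> n i \<v>\<close> by (simp_all add: pure_spinor_def)
  qed
  have x_span: "v \<in> V.span (x ` {1..2*n})" for v
    using \<open>orthonormal_basis scaleV g (2 * n) x\<close>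
    unfolding orthonormal_basis_def indexed_basis_def by blast
  have x_norm: "g (x j) (x j) * g (x j) (x j) = 1" if "j \<in> {1..2*n}" for j
  proof -
    have "g (x j) (x j) = 1 \<or> g (x j) (x j) = - 1"
      using \<open>orthonormal_basis scaleV g (2 * n) x\<close> that unfolding orthonormal_basis_def by blast
    then show ?thesis by auto
  qed
  have x_ortho: "g (x j) (x k) = 0" if "j \<in> {1..2*n}" "k \<in> {1..2*n}" "j \<noteq> k" for j k
    using \<open>orthonormal_basis scaleV g (2 * n) x\<close> that unfolding orthonormal_basis_def by blast
  have x_expand: "v = (\<Sum>j\<in>{1..2*n}. scaleV (g v (scaleV (g (x j) (x j)) (x j))) (x j))" for v
  proof (rule dual_family_expansion[OF g_linear _ _ x_span])
    fix j k assume "j \<in> {1..2*n}" "k \<in> {1..2*n}"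
    then show "g (x j) (scaleV (g (x k) (x k)) (x k)) = (if j = k then 1 else 0)"
      using x_norm[of k] x_ortho[of j k] by (cases "j = k") (simp_all add: g_simps)
  qed simp
  define L2 where "L2 = spinor_L2 scaleV g \<rho> B (2 * n) x"
  have prd: "\<rho> (clifford_product scaleV g vs) s = foldr ?act vs s" for vs s
    by (rule spinor_representation_product[OF \<rho>])
  have state: "foldr ?act (map e K) \<v> = F.state K" for K
    by (simp add: F.state_def foldr_map o_def)
  have L2: "\<rho> (L2 \<phi> \<psi>) s = F.L2_action \<phi> \<psi> s" for \<phi> \<psi> s
  proof -
    let ?P = "{(j, k). 1 \<le> j \<and> j < k \<and> k \<le> 2 * n}"
    let ?t = "\<lambda>(j, k). clifford_scale scaleV g
        (g (x j) (x j) * g (x k) (x k) * B \<phi> (\<rho> (clifford_product scaleV g [x k, x j]) \<psi>))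
        (clifford_product scaleV g [x j, x k])"
    have fin: "finite ?P"
      by (rule finite_subset[of _ "{1..2*n} \<times> {1..2*n}"]) auto
    have scale: "\<rho> (clifford_scale scaleV g c y) s = scaleS c (\<rho> y s)" if "y \<in> carrier ?C" for c y
      by (rule spinor_representation_hom(5)[OF \<rho> that that])
    have "\<rho> (L2 \<phi> \<psi>) s = scaleS (1 / 2) (\<rho> (\<Oplus>\<^bsub>?C\<^esub>p\<in>?P. ?t p) s)"
      unfolding L2_def spinor_L2_def by (intro scale C.finsum_closed) auto
    also have "\<rho> (\<Oplus>\<^bsub>?C\<^esub>p\<in>?P. ?t p) s = (\<Sum>p\<in>?P. \<rho> (?t p) s)"
      by (rule spinor_representation_finsum[OF \<rho> fin]) auto
    also have "\<dots> = (\<Sum>(j, k)\<in>?P. scaleS (g (x j) (x j) * g (x k) (x k) *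
        B \<phi> (?act (x k) (?act (x j) \<psi>))) (?act (x j) (?act (x k) s)))"
      by (rule sum.cong) (auto simp: scale prd)
    also have "scaleS (1 / 2) \<dots> = F.L2_action \<phi> \<psi> s"
      by (rule F.L2_action_eq_orthonormal_sum[OF x_ortho x_norm x_expand])
    finally show ?thesis .
  qed
  have L2_zero: "L2 \<phi> \<psi> = \<zero>\<^bsub>?C\<^esub> \<longleftrightarrow> (\<forall>s. F.L2_action \<phi> \<psi> s = 0)" for \<phi> \<psi>
  proof -
    have closed: "L2 \<phi> \<psi> \<in> carrier ?C"
      unfolding L2_def spinor_L2_def
      by (intro clifford_scale_closed C.finsum_closed) auto
    have zero: "\<rho> \<zero>\<^bsub>?C\<^esub> s = 0" for s
      using spinor_representation_hom(1)[OF \<rho> C.zero_closed C.zero_closed, of s] by simp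
    have "inj_on \<rho> (carrier ?C)"
      using \<rho> by (simp add: spinor_representation_def ring_iso_def bij_betw_def)
    then have "L2 \<phi> \<psi> = \<zero>\<^bsub>?C\<^esub> \<longleftrightarrow> \<rho> (L2 \<phi> \<psi>) = \<rho> \<zero>\<^bsub>?C\<^esub>"
      using closed C.zero_closed by (auto dest: inj_onD)
    then show ?thesis by (simp add: fun_eq_iff zero L2)
  qed
  have I: "distinct I" "set I \<subseteq> {1..n}" and J: "distinct J" "set J \<subseteq> {1..n}"
    using \<open>ordered_subset n I\<close> \<open>ordered_subset n J\<close> by (simp_all add: ordered_subset_def)
  note oI = F.occupied_state[OF I(2)] and oJ = F.occupied_state[OF J(2)]
  have oK: "F.occupied (set K) (F.state K)" if "ordered_subset n K" for K
    using that F.occupied_state by (simp add: ordered_subset_def)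
  let ?disjoint = "set I \<inter> set J = {} \<and> ({1..n} - set I) \<inter> ({1..n} - set J) = {}"
  let ?pairs = "\<exists>a\<in>{1..n}. \<exists>b\<in>{1..n}. a \<noteq> b \<and>
        (set I \<inter> set J = {} \<and> ({1..n} - set I) \<inter> ({1..n} - set J) = {a, b} \<or>
         set I \<inter> set J = {a, b} \<and> ({1..n} - set I) \<inter> ({1..n} - set J) = {} \<or>
         set I \<inter> set J = {b} \<and> ({1..n} - set I) \<inter> ({1..n} - set J) = {a})"
  show ?thesis
    unfolding Let_def L2_def[symmetric] prd foldr_Cons o_apply state L2 L2_zero
  proof (intro conjI iffI allI impI ballI)
    assume nonzero: "\<not> (\<forall>s. F.L2_action (F.state I) (F.state J) s = 0)"
    show "?pairs \<or> ?disjoint"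
    proof (rule ccontr)
      assume none: "\<not> (?pairs \<or> ?disjoint)"
      have "F.L2_action (F.state I) (F.state J) s = 0" for s
      proof (rule F.L2_action_zero[OF oI oJ _ _ \<open>n \<ge> 1\<close>])
        show "\<not> ?disjoint" using none by (rule contrapos_nn) (rule disjI2)
        show "\<not> (set I \<inter> set J = {} \<and> ({1..n} - set I) \<inter> ({1..n} - set J) = {a, b}) \<and>
            \<not> (set I \<inter> set J = {a, b} \<and> ({1..n} - set I) \<inter> ({1..n} - set J) = {}) \<and>
            \<not> (set I \<inter> set J = {b} \<and> ({1..n} - set I) \<inter> ({1..n} - set J) = {a})"
          if "a \<in> {1..n}" "b \<in> {1..n}" "a \<noteq> b" for a b
          using none that by meson
      qed
      with nonzero show False by simp
    qed
  next
    assume "?pairs \<or> ?disjoint"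
    then have "?disjoint \<or> ?pairs" by (rule disj_commute[THEN iffD1])
    from F.L2_action_nonzero[OF I J \<open>n \<ge> 1\<close> this]
    show "\<not> (\<forall>s. F.L2_action (F.state I) (F.state J) s = 0)" by simp
  qed (elim conjE, (rule F.L2_action_pair_added[OF oI oJ] F.L2_action_pair_removed[OF oI oJ]
      F.L2_action_exchange[OF oI oJ] F.L2_action_scalar[OF oI oJ _ _ oK]; assumption))+
qed


end
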